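(* For $0\le\alpha<1$, the sharp $\mathscr{S}^*_{\wp,n}$-radius of $\mathcal{CS}_n(\alpha)$ is $$R_{\mathscr{S}^*_{\wp,n}}(\mathcal{CS}_n(\alpha))=\left(\frac{1/e}{\sqrt{(1+n-\alpha)^2-\frac1e\left(2(1-\alpha)-\frac1e\right)}+1+n-\alpha}\right)^{1/n}.$$
   Context: $\mathbb{D}$ is the unit disk. For $n\ge1$, $\mathcal{A}_n$ is the class of analytic $f$ on $\mathbb{D}$ of the form $f(z)=z+\sum_{k\ge n+1}b_kz^k$, $\mathcal{A}=\mathcal{A}_1$. $f\prec g$ means $f=g\circ\omega$ for analytic $\omega:\mathbb{D}\to\mathbb{D}$, $\omega(0)=0$. $\wp(z)=1+ze^z$, $\mathscr{S}^*_\wp=\{f\in\mathcal{A}:zf'/f\prec\wp\}$, $\mathscr{S}^*_{\wp,n}=\mathcal{A}_n\cap\mathscr{S}^*_\wp$. $\mathcal{P}_n$ is the class of analytic $p(z)=1+\sum_{k\ge n}c_kz^k$ with $\operatorname{Re}p>0$. $\mathcal{S}^*_n(\alpha)=\{g\in\mathcal{A}_n:\operatorname{Re}(zg'/g)>\alpha\}$ and $\mathcal{CS}_n(\alpha)=\{f\in\mathcal{A}_n: f/g\in\mathcal{P}_n \text{ for some } g\in\mathcal{S}^*_n(\alpha)\}$. For classes $G_1,G_2$, $R_{G_1}(G_2)$ is the largest $r_0\in(0,1]$ such that $r^{-1}f(rz)\in G_1$ for all $0<r\le r_0$ and all $f\in G_2$; "sharp" means it cannot be increased. *)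

theory Defs
  imports "HOL-Analysis.Analysis"
begin

abbreviation unit_disk :: "complex set" where
  "unit_disk \<equiv> ball 0 1"

text \<open>Class A_n: f(z) = z + sum_{k>=n+1} b_k z^k, analytic on the unit disk.
  Coefficients are expressed via higher derivatives at 0.\<close>
definition classA :: "nat \<Rightarrow> (complex \<Rightarrow> complex) set" where
  "classA n = {f. f holomorphic_on unit_disk \<and> f 0 = 0 \<and> deriv f 0 = 1 \<and>
      (\<forall>k. 2 \<le> k \<and> k \<le> n \<longrightarrow> (deriv ^^ k) f 0 = 0)}"

definition subord :: "(complex \<Rightarrow> complex) \<Rightarrow> (complex \<Rightarrow> complex) \<Rightarrow> bool" where
  "subord f g \<longleftrightarrow> (\<exists>\<omega>. \<omega> holomorphic_on unit_disk \<and> \<omega> ` unit_disk \<subseteq> unit_disk \<and>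
      \<omega> 0 = 0 \<and> (\<forall>z\<in>unit_disk. f z = g (\<omega> z)))"

definition wp :: "complex \<Rightarrow> complex" where
  "wp z = 1 + z * exp z"

text \<open>z f'(z)/f(z), with its removable value 1 at the origin (f'(0)=1).\<close>
definition logd :: "(complex \<Rightarrow> complex) \<Rightarrow> complex \<Rightarrow> complex" where
  "logd f z = (if z = 0 then 1 else z * deriv f z / f z)"

definition Swp :: "(complex \<Rightarrow> complex) set" where
  "Swp = {f. f \<in> classA 1 \<and> subord (logd f) wp}"

definition Swp_n :: "nat \<Rightarrow> (complex \<Rightarrow> complex) set" where
  "Swp_n n = classA n \<inter> Swp"

definition classP :: "nat \<Rightarrow> (complex \<Rightarrow> complex) set" where
  "classP n = {p. p holomorphic_on unit_disk \<and> p 0 = 1 \<and>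
      (\<forall>k. 1 \<le> k \<and> k < n \<longrightarrow> (deriv ^^ k) p 0 = 0) \<and>
      (\<forall>z\<in>unit_disk. Re (p z) > 0)}"

definition starlike_n :: "nat \<Rightarrow> real \<Rightarrow> (complex \<Rightarrow> complex) set" where
  "starlike_n n \<alpha> = {g. g \<in> classA n \<and> (\<forall>z\<in>unit_disk. Re (logd g z) > \<alpha>)}"

text \<open>f/g with its removable value 1 at the origin (f'(0)=g'(0)=1).\<close>
definition quot0 :: "(complex \<Rightarrow> complex) \<Rightarrow> (complex \<Rightarrow> complex) \<Rightarrow> complex \<Rightarrow> complex" where
  "quot0 f g z = (if z = 0 then 1 else f z / g z)"

definition CS_n :: "nat \<Rightarrow> real \<Rightarrow> (complex \<Rightarrow> complex) set" where
  "CS_n n \<alpha> = {f. f \<in> classA n \<and> (\<exists>g\<in>starlike_n n \<alpha>. quot0 f g \<in> classP n)}"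

definition dilate :: "real \<Rightarrow> (complex \<Rightarrow> complex) \<Rightarrow> complex \<Rightarrow> complex" where
  "dilate r f z = f (of_real r * z) / of_real r"

definition radius :: "(complex \<Rightarrow> complex) set \<Rightarrow> (complex \<Rightarrow> complex) set \<Rightarrow> real" where
  "radius G1 G2 = (GREATEST r0. 0 < r0 \<and> r0 \<le> 1 \<and>
      (\<forall>r. 0 < r \<and> r \<le> r0 \<longrightarrow> (\<forall>f\<in>G2. dilate r f \<in> G1)))"

end

theory Submission
  imports Defs "HOL-Complex_Analysis.Complex_Analysis"
begin

text \<open>
  Put \<open>R = |z|\<^sup>n\<close>. Schwarz's lemma for \<open>g\<close> and the Schwarz--Pick lemma for \<open>p = f / g\<close> place
  \<open>z f'(z) / f(z)\<close> in the disk with centre \<open>1 + 2 (1 - \<alpha>) R\<^sup>2 / (1 - R\<^sup>2)\<close> and radius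
  \<open>2 (1 + n - \<alpha>) R / (1 - R\<^sup>2)\<close>. The function \<open>z exp z\<close> is univalent on the unit disk, and its
  image contains the disk around a small \<open>c \<ge> 0\<close> of radius \<open>c + 1 / e\<close>, which touches the boundary
  of the image at the value \<open>- 1 / e\<close> of the point \<open>- 1\<close>. Hence the condition on \<open>R\<close> is
  \<open>1 / e - 2 (1 + n - \<alpha>) R + (2 (1 - \<alpha>) - 1 / e) R\<^sup>2 \<ge> 0\<close>, whose smallest root is the asserted
  value. For sharpness, \<open>z (1 - z\<^sup>n) (1 + z\<^sup>n) powr (- (n + 2 - 2 \<alpha>) / n)\<close> attains the leftmost
  point of each disk at positive \<open>z\<close>.
\<close>

subsection \<open>Schwarz lemmas\<close>

text \<open>Induction on \<open>m\<close>, splitting off one factor \<open>z\<close> at a time. In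
  Leibniz's rule for \<open>z * h z\<close> at 0 only the term with the first derivative of
  \<open>z\<close> survives, so the derivative of order \<open>k + 1\<close> is \<open>k + 1\<close>
  times the \<open>k\<close>-th derivative of \<open>h\<close>, and the vanishing conditions pass to
  \<open>h\<close> with one order less.\<close>

lemma holomorphic_factor_power:
  fixes f :: "complex \<Rightarrow> complex"
  assumes "f holomorphic_on ball 0 r" "0 < r"
    and "\<And>k. k < m \<Longrightarrow> (deriv ^^ k) f 0 = 0"
  obtains h where "h holomorphic_on ball 0 r" "\<And>z. z \<in> ball 0 r \<Longrightarrow> f z = z ^ m * h z"
proof -
  have "\<exists>h. h holomorphic_on ball 0 r \<and> (\<forall>z\<in>ball 0 r. f z = z ^ m * h z)"
    using assms(1,3)
  proof (induction m arbitrary: f)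
    case 0
    then show ?case by auto
  next
    case (Suc m)
    have "f 0 = 0" using Suc.prems(2)[of 0] by simp
    then obtain h where h: "h holomorphic_on ball 0 r" "\<And>z. norm z < r \<Longrightarrow> f z = z * h z"
      using Schwarz3[OF Suc.prems(1)] by metis
    have "(deriv ^^ k) h 0 = 0" if "k < m" for k
    proof -
      have "(deriv ^^ Suc k) f 0 = (deriv ^^ Suc k) (\<lambda>z. z * h z) 0"
        by (rule higher_deriv_transform_within_open[OF Suc.prems(1), of _ ])
          (use h assms(2) in \<open>auto intro!: holomorphic_intros\<close>)
      also have "\<dots> = (\<Sum>i = 0..Suc k. of_nat (Suc k choose i) * (deriv ^^ i) (\<lambda>w. w) 0 * (deriv ^^ (Suc k - i)) h 0)"
        by (rule higher_deriv_mult[where S = "ball 0 r"]) (use h assms(2) in \<open>auto intro!: holomorphic_intros\<close>)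
      also have "\<dots> = (\<Sum>i\<in>{1}. of_nat (Suc k choose i) * (deriv ^^ i) (\<lambda>w. w) 0 * (deriv ^^ (Suc k - i)) h 0)"
        by (rule sum.mono_neutral_right) (auto simp: higher_deriv_ident)
      also have "\<dots> = of_nat (Suc k) * (deriv ^^ k) h 0"
        by simp
      finally show ?thesis using Suc.prems(2)[of "Suc k"] that
        by (metis Suc_less_eq mult_eq_0_iff of_nat_neq_0)
    qed
    then obtain h' where "h' holomorphic_on ball 0 r" "\<forall>z\<in>ball 0 r. h z = z ^ m * h' z"
      using Suc.IH h by blast
    then show ?case using h by (intro exI[of _ h']) auto
  qed
  then show ?thesis using that by blast
qed

text \<open>Converse of \<open>holomorphic_factor_power\<close>: every Leibniz term contains a
  derivative of \<open>w ^ m\<close> of order below \<open>m\<close>, which vanishes at 0.\<close>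

lemma higher_deriv_power_mult_0:
  fixes f h :: "complex \<Rightarrow> complex"
  assumes "h holomorphic_on ball 0 r" "0 < r" "\<And>z. z \<in> ball 0 r \<Longrightarrow> f z = z ^ m * h z" "k < m"
  shows "(deriv ^^ k) f 0 = 0"
proof -
  have "f holomorphic_on ball 0 r \<longleftrightarrow> (\<lambda>z. z ^ m * h z) holomorphic_on ball 0 r"
    by (rule holomorphic_cong) (use assms in auto)
  then have "f holomorphic_on ball 0 r" using assms by (auto intro!: holomorphic_intros)
  then have "(deriv ^^ k) f 0 = (deriv ^^ k) (\<lambda>z. z ^ m * h z) 0"
    by (rule higher_deriv_transform_within_open) (use assms in \<open>auto intro!: holomorphic_intros\<close>)
  also have "\<dots> = (\<Sum>i = 0..k. of_nat (k choose i) * (deriv ^^ i) (\<lambda>w. w ^ m) 0 * (deriv ^^ (k - i)) h 0)"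
    by (rule higher_deriv_mult[where S = "ball 0 r"]) (use assms in \<open>auto intro!: holomorphic_intros\<close>)
  also have "\<dots> = 0"
  proof (rule sum.neutral, rule ballI)
    fix i assume "i \<in> {0..k}"
    then have "(deriv ^^ i) (\<lambda>w. w ^ m) (0::complex) = 0"
      using higher_deriv_power[of i 0 m 0] assms(4) by (simp add: power_0_left)
    then show "of_nat (k choose i) * (deriv ^^ i) (\<lambda>w. w ^ m) 0 * (deriv ^^ (k - i)) h 0 = 0" by simp
  qed
  finally show ?thesis .
qed

text \<open>Schwarz's lemma for a zero of order \<open>n\<close>: the circle of radius \<rho> gives
  the bound \<open>1 / \<rho> ^ n\<close>, the maximum principle carries it inside, and \<rho> tends
  to 1.\<close>

lemma norm_le_1_of_power_mult:
  fixes \<phi> :: "complex \<Rightarrow> complex"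
  assumes hol: "\<phi> holomorphic_on ball 0 1"
    and le: "\<And>z. z \<in> ball 0 1 \<Longrightarrow> norm (z ^ n * \<phi> z) \<le> 1"
    and z: "z \<in> ball 0 1"
  shows "norm (\<phi> z) \<le> 1"
proof -
  have *: "norm (\<phi> z) * \<rho> ^ n \<le> 1" if "norm z < \<rho>" "\<rho> < 1" for \<rho>
  proof -
    have \<rho>: "0 < \<rho>" using that norm_ge_zero[of z] by linarith
    have "norm (\<phi> z) \<le> 1 / \<rho> ^ n"
    proof (rule maximum_modulus_frontier[where f = \<phi> and \<xi> = z and S = "cball 0 \<rho>"])
      have sub: "cball 0 \<rho> \<subseteq> ball (0::complex) 1" using \<open>\<rho> < 1\<close> by auto
      show "\<phi> holomorphic_on interior (cball 0 \<rho>)"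
        using holomorphic_on_subset[OF hol] sub interior_subset by blast
      show "continuous_on (closure (cball 0 \<rho>)) \<phi>"
        using continuous_on_subset[OF holomorphic_on_imp_continuous_on[OF hol]] sub by simp
      show "norm (\<phi> w) \<le> 1 / \<rho> ^ n" if "w \<in> frontier (cball 0 \<rho>)" for w
      proof -
        have "norm w = \<rho>" using that by (simp add: sphere_def)
        then show ?thesis using le[of w] \<open>\<rho> < 1\<close> \<rho>
          by (simp add: norm_mult norm_power field_simps)
      qed
    qed (use that in auto)
    then show ?thesis using \<rho> by (simp add: field_simps)
  qed
  have "((\<lambda>\<rho>. norm (\<phi> z) * \<rho> ^ n) \<longlongrightarrow> norm (\<phi> z) * 1 ^ n) (at_left 1)"
    by (intro tendsto_intros)
  moreover have "eventually (\<lambda>\<rho>. norm (\<phi> z) * \<rho> ^ n \<le> 1) (at_left 1)"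
    using z by (auto simp: eventually_at_left_field intro!: exI[of _ "norm z"] *)
  ultimately show ?thesis
    using tendsto_upperbound[of "\<lambda>\<rho>. norm (\<phi> z) * \<rho> ^ n" "norm (\<phi> z) * 1 ^ n" "at_left 1" 1] by simp
qed

lemma has_field_derivative_Moebius_function:
  assumes "1 - cnj w * z \<noteq> 0"
  shows "(Moebius_function 0 w has_field_derivative
    of_real (1 - (norm w)\<^sup>2) / (1 - cnj w * z)\<^sup>2) (at z)"
proof -
  have "((\<lambda>z. (z - w) / (1 - cnj w * z)) has_field_derivative
    of_real (1 - (norm w)\<^sup>2) / (1 - cnj w * z)\<^sup>2) (at z)"
    by (rule derivative_eq_intros refl assms)+
      (use complex_norm_square[of w] in \<open>auto simp: power2_eq_square algebra_simps\<close>)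
  moreover have "Moebius_function 0 w = (\<lambda>z. (z - w) / (1 - cnj w * z))"
    by (auto simp: Moebius_function_simple)
  ultimately show ?thesis by simp
qed

text \<open>Moebius maps move \<open>z\<close> and \<open>\<phi> z\<close> to 0, so the derivative
  bound of Schwarz's lemma applies to the conjugated map \<open>F\<close>; the chain rule translates
  it back. Strictness puts \<open>\<phi> z\<close> inside the open disk, where its Moebius map
  preserves the disk.\<close>

lemma Schwarz_Pick_strict:
  fixes \<phi> :: "complex \<Rightarrow> complex"
  assumes hol: "\<phi> holomorphic_on ball 0 1"
    and lt: "\<And>z. z \<in> ball 0 1 \<Longrightarrow> norm (\<phi> z) < 1"
    and z: "z \<in> ball 0 1"
  shows "norm (deriv \<phi> z) * (1 - (norm z)\<^sup>2) \<le> 1 - (norm (\<phi> z))\<^sup>2"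
proof -
  define w where "w = \<phi> z"
  define F where "F = (\<lambda>\<zeta>. Moebius_function 0 w (\<phi> (Moebius_function 0 (-z) \<zeta>)))"
  have w: "norm w < 1" and z1: "norm z < 1" using lt z by (auto simp: w_def)
  have M0: "Moebius_function 0 (-z) 0 = z" by (simp add: Moebius_function_of_zero)
  have M1: "Moebius_function 0 (-z) \<zeta> \<in> ball 0 1" if "\<zeta> \<in> ball 0 1" for \<zeta>
    using Moebius_function_norm_lt_1[of "-z" \<zeta>] z1 that by simp
  have "F holomorphic_on ball 0 1"
  proof -
    have "(Moebius_function 0 w \<circ> (\<phi> \<circ> Moebius_function 0 (-z))) holomorphic_on ball 0 1"
    proof (rule holomorphic_on_compose_gen)
      show "(\<phi> \<circ> Moebius_function 0 (-z)) holomorphic_on ball 0 1"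
        by (rule holomorphic_on_compose_gen[OF Moebius_function_holomorphic hol])
          (use M1 z1 in auto)
      show "Moebius_function 0 w holomorphic_on ball 0 1"
        by (rule Moebius_function_holomorphic[OF w])
      show "(\<phi> \<circ> Moebius_function 0 (-z)) ` ball 0 1 \<subseteq> ball 0 1"
        using lt M1 by fastforce
    qed
    then show ?thesis by (simp add: F_def o_def)
  qed
  moreover have "F 0 = 0" by (simp add: F_def M0 Moebius_function_eq_zero flip: w_def)
  moreover have "norm (F \<zeta>) < 1" if "norm \<zeta> < 1" for \<zeta>
    unfolding F_def using that by (intro Moebius_function_norm_lt_1 w lt M1) simp
  ultimately have F': "norm (deriv F 0) \<le> 1"
    using Schwarz_Lemma(2)[of F 0] by simp
  have w2: "(norm w)\<^sup>2 < 1" using w by (simp add: abs_square_less_1)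
  have ww: "1 - cnj w * w = of_real (1 - (norm w)\<^sup>2)"
    using complex_norm_square[of w] by (simp add: mult.commute)
  have ne: "1 - cnj w * w \<noteq> 0" unfolding ww of_real_eq_0_iff using w2 by simp
  have d1: "(Moebius_function 0 w has_field_derivative of_real (1 - (norm w)\<^sup>2) / (1 - cnj w * w)\<^sup>2) (at (\<phi> z))"
    using has_field_derivative_Moebius_function[OF ne] by (simp add: w_def)
  have d2: "(\<phi> has_field_derivative deriv \<phi> z) (at (Moebius_function 0 (-z) 0))"
    unfolding M0 using hol z by (intro holomorphic_derivI[where S = "ball 0 1"]) auto
  have d3: "(Moebius_function 0 (-z) has_field_derivative of_real (1 - (norm z)\<^sup>2)) (at 0)"
    using has_field_derivative_Moebius_function[of "-z" 0] by simp
  have d23: "((\<lambda>\<zeta>. \<phi> (Moebius_function 0 (-z) \<zeta>)) has_field_derivative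
      deriv \<phi> z * of_real (1 - (norm z)\<^sup>2)) (at 0)"
    by (rule DERIV_chain2[OF d2 d3])
  have "(F has_field_derivative
      of_real (1 - (norm w)\<^sup>2) / (1 - cnj w * w)\<^sup>2 * (deriv \<phi> z * of_real (1 - (norm z)\<^sup>2))) (at 0)"
    unfolding F_def by (rule DERIV_chain2[OF _ d23]) (use d1 M0 in simp)
  then have "deriv F 0 = of_real (1 - (norm w)\<^sup>2) / (1 - cnj w * w)\<^sup>2 * (deriv \<phi> z * of_real (1 - (norm z)\<^sup>2))"
    by (rule DERIV_imp_deriv)
  also have "\<dots> = deriv \<phi> z * of_real (1 - (norm z)\<^sup>2) / of_real (1 - (norm w)\<^sup>2)"
    using ne unfolding ww by (simp add: power2_eq_square)
  finally have "norm (deriv F 0) = norm (deriv \<phi> z) * \<bar>1 - (norm z)\<^sup>2\<bar> / \<bar>1 - (norm w)\<^sup>2\<bar>"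
    by (simp add: norm_mult norm_divide del: of_real_diff)
  moreover have "(norm z)\<^sup>2 < 1" using z1 by (simp add: abs_square_less_1)
  ultimately show ?thesis using F' w2 by (simp add: w_def)
qed

text \<open>The strict form is applied to \<open>s * \<phi>\<close> with \<open>s < 1\<close>, and
  \<open>s\<close> tends to 1. The weak hypothesis is the one that
  \<open>norm_le_1_of_power_mult\<close> delivers; unimodular constants do occur.\<close>

lemma Schwarz_Pick:
  fixes \<phi> :: "complex \<Rightarrow> complex"
  assumes hol: "\<phi> holomorphic_on ball 0 1"
    and le: "\<And>z. z \<in> ball 0 1 \<Longrightarrow> norm (\<phi> z) \<le> 1"
    and z: "z \<in> ball 0 1"
  shows "norm (deriv \<phi> z) * (1 - (norm z)\<^sup>2) \<le> 1 - (norm (\<phi> z))\<^sup>2"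
proof -
  have *: "s * norm (deriv \<phi> z) * (1 - (norm z)\<^sup>2) \<le> 1 - (s * norm (\<phi> z))\<^sup>2" if "0 < s" "s < 1" for s
  proof -
    have "norm (deriv (\<lambda>z. of_real s * \<phi> z) z) * (1 - (norm z)\<^sup>2) \<le> 1 - (norm (of_real s * \<phi> z))\<^sup>2"
    proof (rule Schwarz_Pick_strict)
      show "norm (of_real s * \<phi> z) < 1" if "z \<in> ball 0 1" for z
        using le[OF that] \<open>0 < s\<close> \<open>s < 1\<close> mult_left_le[of "norm (\<phi> z)" s]
        unfolding norm_mult norm_of_real by linarith
    qed (use hol z in \<open>auto intro!: holomorphic_intros\<close>)
    moreover have "deriv (\<lambda>z. of_real s * \<phi> z) z = of_real s * deriv \<phi> z"
      by (rule deriv_cmult) (use hol z in \<open>auto intro: holomorphic_on_imp_differentiable_at\<close>)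
    ultimately show ?thesis using that by (simp add: norm_mult)
  qed
  have "((\<lambda>s. 1 - (s * norm (\<phi> z))\<^sup>2 - s * norm (deriv \<phi> z) * (1 - (norm z)\<^sup>2)) \<longlongrightarrow>
      1 - (1 * norm (\<phi> z))\<^sup>2 - 1 * norm (deriv \<phi> z) * (1 - (norm z)\<^sup>2)) (at_left 1)"
    by (intro tendsto_intros)
  moreover have "eventually (\<lambda>s. 0 \<le> 1 - (s * norm (\<phi> z))\<^sup>2 - s * norm (deriv \<phi> z) * (1 - (norm z)\<^sup>2)) (at_left 1)"
    using * by (auto simp: eventually_at_left_field intro!: exI[of _ 0])
  ultimately have "0 \<le> 1 - (1 * norm (\<phi> z))\<^sup>2 - 1 * norm (deriv \<phi> z) * (1 - (norm z)\<^sup>2)"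
    by (rule tendsto_lowerbound) simp
  then show ?thesis by simp
qed

subsection \<open>The map \<open>z exp z\<close>\<close>

lemma norm_exp_diff_le:
  fixes u v :: complex
  assumes "Re u \<le> B" "Re v \<le> B"
  shows "norm (exp u - exp v) \<le> exp B * norm (u - v)"
proof (rule field_differentiable_bound[where S = "{z. Re z \<le> B}" and f' = exp])
  show "convex {z. Re z \<le> B}" by (rule convex_halfspace_Re_le)
  show "(exp has_field_derivative exp z) (at z within {z. Re z \<le> B})" for z :: complex
    by (rule DERIV_exp[THEN has_field_derivative_at_within])
qed (use assms in auto)

text \<open>Writing \<open>z = exp u\<close>, the map becomes \<open>u + exp u\<close> on the left half plane, where \<open>exp\<close> is a
  strict contraction.\<close>
lemma inj_on_mult_exp: "inj_on (\<lambda>z::complex. z * exp z) (ball 0 1)"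
proof (rule inj_onI)
  fix x y :: complex
  assume xy: "x \<in> ball 0 1" "y \<in> ball 0 1" and eq: "x * exp x = y * exp y"
  show "x = y"
  proof (cases "x = 0 \<or> y = 0")
    case True
    then show ?thesis using eq by auto
  next
    case False
    define u where "u = Ln x"
    have u: "exp u = x" "Re u < 0" using False xy by (auto simp: u_def)
    have "exp (u + x) = exp (Ln y + y)"
      using False eq u by (simp add: exp_add)
    then obtain k :: int where k: "u + x = Ln y + y + of_int (2 * k) * of_real pi * \<i>"
      unfolding exp_eq by auto
    \<comment> \<open>The logarithm of \<open>y\<close> that absorbs the period, so that
      \<open>u + exp u = v + exp v\<close> holds exactly.\<close>
    define v where "v = Ln y + of_int (2 * k) * of_real pi * \<i>"
    have v: "exp v = y" "Re v < 0"
    proof -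
      have "exp v = exp (Ln y)" unfolding exp_eq v_def by (intro exI[of _ k]) simp
      then show "exp v = y" using False by simp
      show "Re v < 0" using False xy by (simp add: v_def)
    qed
    have "u - v = exp v - exp u" using k u v by (simp add: v_def algebra_simps)
    then have "norm (u - v) = norm (exp u - exp v)" by (metis norm_minus_commute)
    also have "\<dots> \<le> exp (max (Re u) (Re v)) * norm (u - v)"
      by (rule norm_exp_diff_le) auto
    finally have "(1 - exp (max (Re u) (Re v))) * norm (u - v) \<le> 0" by (simp add: algebra_simps)
    moreover have "0 < 1 - exp (max (Re u) (Re v))" using u v by simp
    ultimately have "norm (u - v) \<le> 0" by (metis mult_le_0_iff not_less)
    then have "u = v" by simp
    then show ?thesis using u v by simp
  qed
qed

section \<open>Disks inside the image of \<open>z exp z\<close>\<close>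

text \<open>For \<open>x > 0\<close> the mean value theorem gives
  \<open>x - sin x = x * (1 - cos \<xi>)\<close> with \<xi> between 0 and \<open>x\<close>, and
  cosine decreases on \<open>[0, pi]\<close>. Negative \<open>x\<close> follow by symmetry.\<close>

lemma abs_diff_sin_le:
  fixes x :: real
  assumes "\<bar>x\<bar> \<le> pi"
  shows "\<bar>x - sin x\<bar> \<le> \<bar>x\<bar> * (1 - cos x)"
proof -
  have pos: "\<bar>x - sin x\<bar> \<le> x * (1 - cos x)" if x: "0 < x" "x \<le> pi" for x :: real
  proof -
    have "\<exists>\<xi>. \<xi> > 0 \<and> \<xi> < x \<and> (x - sin x) - (0 - sin 0) = (x - 0) * (1 - cos \<xi>)"
      by (rule MVT2) (use x in \<open>auto intro!: derivative_eq_intros\<close>)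
    then obtain \<xi> where \<xi>: "0 < \<xi>" "\<xi> < x" "x - sin x = x * (1 - cos \<xi>)" by auto
    have "cos x \<le> cos \<xi>" using \<xi> x by (intro cos_monotone_0_pi_le) auto
    moreover have "0 \<le> x - sin x" using sin_x_le_x[of x] x by simp
    ultimately show ?thesis using \<xi> x by (simp add: mult_left_mono)
  qed
  consider "x = 0" | "0 < x" | "x < 0" by linarith
  then show ?thesis
  proof cases
    case 3
    then show ?thesis using pos[of "-x"] assms by simp
  qed (use pos assms in auto)
qed

lemma one_minus_cos_le_abs: "1 - cos x \<le> \<bar>x :: real\<bar>"
proof -
  have "1 - cos x = 2 * (sin (x / 2))\<^sup>2"
    using cos_double_sin[of "x / 2"] by simp
  also have "(sin (x / 2))\<^sup>2 \<le> \<bar>sin (x / 2)\<bar>"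
    using mult_left_le[of "\<bar>sin (x / 2)\<bar>" "\<bar>sin (x / 2)\<bar>"] by (simp add: power2_eq_square flip: abs_mult)
  also have "\<dots> \<le> \<bar>x / 2\<bar>" by (rule abs_sin_x_le_abs_x)
  finally show ?thesis by simp
qed

text \<open>With \<open>z = - cis \<phi>\<close> the value \<open>z * exp z\<close> is
  \<open>- exp (-1) * Y * cis \<psi>\<close>, where \<open>Y >= 1\<close>. Squaring and dividing by
  \<open>(exp (-1))^2\<close> turns the claim into
  \<open>1 + k \<le> Y^2 + k * Y * cos \<psi>\<close>, with equality at \<open>z = -1\<close>. The
  growth of \<open>Y\<close> outweighs the rotation by \<psi> as long as
  \<open>4 * k \<le> 1\<close>, which is the bound on \<open>c\<close>.\<close>

lemma norm_mult_exp_diff_ge: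
  fixes z :: complex and c :: real
  assumes z: "norm z = 1" and c: "0 \<le> c" "c \<le> exp (-1) / 8"
  shows "c + exp (-1) \<le> norm (z * exp z - of_real c)"
proof -
  \<comment> \<open>The angle is measured from the point of contact \<open>-1\<close>.\<close>
  define \<phi> where "\<phi> = Arg (-z)"
  have \<phi>: "\<bar>\<phi>\<bar> \<le> pi" using Arg_bounded[of "-z"] by (simp add: \<phi>_def abs_le_iff)
  have "- z = cis \<phi>" using z rcis_cmod_Arg[of "-z"] by (simp add: \<phi>_def rcis_def)
  then have z_eq: "z = - cis \<phi>" by (metis minus_minus)
  define \<psi> where "\<psi> = \<phi> - sin \<phi>"
  define y where "y = 1 - cos \<phi>"
  define Y where "Y = exp y"
  define k where "k = 2 * c * exp 1"
  have e: "exp 1 * exp (-1) = (1::real)" by (simp flip: exp_add)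
  have y: "0 \<le> y" "y \<le> Y - 1" using exp_ge_add_one_self[of y] by (auto simp: y_def Y_def)
  have k: "0 \<le> k" "4 * k \<le> 1"
  proof -
    show "0 \<le> k" using c by (simp add: k_def)
    have "4 * k \<le> 8 * (exp (-1) / 8) * exp 1" unfolding k_def
      using mult_right_mono[OF c(2), of "8 * exp 1"] by (simp add: algebra_simps)
    then show "4 * k \<le> 1" using e by (simp add: mult.commute)
  qed
  have "1 - cos \<psi> \<le> \<bar>\<phi>\<bar> * y"
    using one_minus_cos_le_abs[of \<psi>] abs_diff_sin_le[OF \<phi>] by (simp add: \<psi>_def y_def)
  \<comment> \<open>The 4 is a bound for \<open>pi\<close>, and
    \<open>y \<le> exp y - 1\<close>.\<close>
  also have "\<dots> \<le> 4 * (Y - 1)"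
    using \<phi> pi_less_4 y by (intro mult_mono) auto
  finally have "k * Y * (1 - cos \<psi>) \<le> k * Y * (4 * (Y - 1))"
    using k by (intro mult_left_mono) (auto simp: Y_def)
  also have "\<dots> = 4 * k * (Y * (Y - 1))" by simp
  also have "\<dots> \<le> 1 * (Y * (Y - 1))"
    using k y by (intro mult_right_mono) (auto simp: Y_def)
  also have "\<dots> \<le> (Y - 1) * (Y + 1 + k)"
    using k y mult_left_mono[of Y "Y + 1 + k" "Y - 1"] by (simp add: mult.commute)
  finally have main: "1 + k \<le> Y\<^sup>2 + k * Y * cos \<psi>"
    by (simp add: algebra_simps power2_eq_square)
  have "exp z = of_real (exp (- cos \<phi>)) * cis (- sin \<phi>)"
    by (simp add: z_eq exp_eq_polar)
  moreover have "exp (- cos \<phi>) = exp (-1) * Y" by (simp add: Y_def y_def flip: exp_add)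
  ultimately have "z * exp z = - (of_real (exp (-1) * Y) * cis \<psi>)"
    by (simp add: z_eq \<psi>_def cis_mult mult.left_commute)
  then have "(norm (z * exp z - of_real c))\<^sup>2 = (exp (-1) * Y * cos \<psi> + c)\<^sup>2 + (exp (-1) * Y * sin \<psi>)\<^sup>2"
    by (simp add: cmod_power2) (simp add: algebra_simps power2_eq_square)
  also have "\<dots> = (exp (-1) * Y)\<^sup>2 * ((sin \<psi>)\<^sup>2 + (cos \<psi>)\<^sup>2) + 2 * c * (exp (-1) * Y * cos \<psi>) + c\<^sup>2"
    by algebra
  also have "\<dots> = (exp (-1))\<^sup>2 * (Y\<^sup>2 + k * Y * cos \<psi>) + c\<^sup>2"
  proof -
    have "2 * c = k * exp (-1)" using e by (simp add: k_def mult.assoc)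
    then show ?thesis by (simp add: algebra_simps power2_eq_square)
  qed
  also have "\<dots> \<ge> (exp (-1))\<^sup>2 * (1 + k) + c\<^sup>2"
    using main by (intro add_right_mono mult_left_mono) auto
  also have "(exp (-1))\<^sup>2 * (1 + k) + c\<^sup>2 = (c + exp (-1))\<^sup>2"
  proof -
    have "k * exp (-1) = 2 * c" using e by (simp add: k_def mult.assoc)
    then show ?thesis by (simp add: algebra_simps power2_eq_square)
  qed
  finally show ?thesis by (rule power2_le_imp_le) simp
qed

text \<open>By connectedness, a ball that contains the value 0 but leaves the image meets the
  frontier of the image. The image is open and its closure lies in the compact image of the closed
  disk, so such a frontier point is a value at some \<open>z\<close> with \<open>norm z = 1\<close>;
  \<open>norm_mult_exp_diff_ge\<close> keeps those out of the ball.\<close>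

lemma ball_subset_mult_exp_image:
  fixes c :: real
  assumes c: "0 \<le> c" "c \<le> exp (-1) / 8"
  shows "ball (of_real c) (c + exp (-1)) \<subseteq> (\<lambda>z::complex. z * exp z) ` ball 0 1"
    (is "?B \<subseteq> ?f ` _")
proof (rule ccontr)
  assume "\<not> ?thesis"
  moreover have "0 \<in> ?B" using c by simp
  moreover have "0 \<in> ?f ` ball 0 1" by (rule image_eqI[of _ _ 0]) auto
  ultimately have "?B \<inter> frontier (?f ` ball 0 1) \<noteq> {}"
    by (intro connected_Int_frontier connected_ball) blast+
  then obtain w where w: "w \<in> ?B" "w \<in> frontier (?f ` ball 0 1)" by auto
  have "open (?f ` ball 0 1)"
    by (rule open_mapping_thm3) (auto intro!: holomorphic_intros inj_on_mult_exp)
  then have notin: "w \<notin> ?f ` ball 0 1" using w by (simp add: frontier_def interior_open)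
  have "compact (?f ` cball 0 1)"
    by (intro compact_continuous_image continuous_intros) auto
  then have "closure (?f ` ball 0 1) \<subseteq> ?f ` cball 0 1"
    by (intro closure_minimal image_mono compact_imp_closed) auto
  then obtain z where z: "w = ?f z" "norm z \<le> 1" using w by (auto simp: frontier_def)
  with notin have "norm z = 1" by force
  then show False
    using norm_mult_exp_diff_ge[OF _ c, of z] w z by (simp add: dist_norm norm_minus_commute)
qed

text \<open>The tangent inequality \<open>exp t >= 1 + t\<close> at \<open>t = - u - 1\<close>, with
  equality at \<open>u = -1\<close>.\<close>

lemma real_mult_exp_ge: "- exp (-1) \<le> u * exp (u::real)"
proof -
  have "- u * exp u \<le> exp (- u - 1) * exp u"
    using exp_ge_add_one_self[of "- u - 1"] by (intro mult_right_mono) auto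
  also have "\<dots> = exp (-1)" by (simp flip: exp_add)
  finally show ?thesis by simp
qed

text \<open>A preimage of a real number is real, as its conjugate is another preimage.\<close>
lemma of_real_notin_mult_exp_image:
  assumes "x < - exp (-1)"
  shows "of_real x \<notin> (\<lambda>z::complex. z * exp z) ` ball 0 1"
proof
  assume "of_real x \<in> (\<lambda>z::complex. z * exp z) ` ball 0 1"
  then obtain u :: complex where u: "u \<in> ball 0 1" "of_real x = u * exp u" by auto
  have "cnj u * exp (cnj u) = u * exp u"
    using u(2) by (metis complex_cnj_complex_of_real complex_cnj_mult exp_cnj)
  then have "cnj u = u" using inj_onD[OF inj_on_mult_exp, of "cnj u" u] u by simp
  then have "u = of_real (Re u)" by (simp add: complex_eq_iff)
  then have "of_real x = complex_of_real (Re u * exp (Re u))"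
    using u(2) by (metis exp_of_real of_real_mult)
  then have "x = Re u * exp (Re u)" by (simp only: of_real_eq_iff)
  then show False using real_mult_exp_ge[of "Re u"] assms by simp
qed

subsection \<open>Coefficient conditions and growth estimates\<close>

text \<open>Replaces the conditions on derivatives at 0 by a factorization: \<open>f z - z\<close>
  vanishes to order \<open>n + 1\<close>.\<close>

lemma classA_factor:
  assumes f: "f \<in> classA n"
  obtains h where "h holomorphic_on ball 0 1" "\<And>z. z \<in> ball 0 1 \<Longrightarrow> f z = z * (1 + z ^ n * h z)"
proof -
  have hol: "f holomorphic_on ball 0 1" using f by (simp add: classA_def)
  then have hol': "(\<lambda>z. f z - z) holomorphic_on ball 0 1" by (intro holomorphic_intros)
  have "(deriv ^^ k) (\<lambda>z. f z - z) 0 = 0" if "k < Suc n" for k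
  proof -
    have "(deriv ^^ k) (\<lambda>z. f z - z) 0 = (deriv ^^ k) f 0 - (deriv ^^ k) (\<lambda>z. z) 0"
      by (rule higher_deriv_diff[OF hol]) (auto intro!: holomorphic_intros)
    moreover consider "k = 0" | "k = 1" | "2 \<le> k" by linarith
    then have "(deriv ^^ k) f 0 = (deriv ^^ k) (\<lambda>z. z) 0"
      by cases (use f that in \<open>auto simp: classA_def\<close>)
    ultimately show ?thesis by simp
  qed
  then obtain h where h: "h holomorphic_on ball 0 1" "\<And>z. z \<in> ball 0 1 \<Longrightarrow> f z - z = z ^ Suc n * h z"
    using holomorphic_factor_power[OF hol' zero_less_one] by blast
  have "f z = z * (1 + z ^ n * h z)" if "z \<in> ball 0 1" for z
    using h(2)[OF that] by (simp add: algebra_simps)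
  then show ?thesis using that h(1) by blast
qed

lemma classA_I:
  assumes "1 \<le> n" and h: "h holomorphic_on ball 0 1"
    and f: "\<And>z. z \<in> ball 0 1 \<Longrightarrow> f z = z * (1 + z ^ n * h z)"
  shows "f \<in> classA n"
proof -
  have "f holomorphic_on ball 0 1 \<longleftrightarrow> (\<lambda>z. z * (1 + z ^ n * h z)) holomorphic_on ball 0 1"
    by (rule holomorphic_cong) (use f in auto)
  then have hol: "f holomorphic_on ball 0 1" using h by (auto intro!: holomorphic_intros)
  have *: "(deriv ^^ k) f 0 = (deriv ^^ k) (\<lambda>z. z) 0" if "k \<le> n" for k
  proof -
    have "(deriv ^^ k) (\<lambda>z. f z - z) 0 = (deriv ^^ k) f 0 - (deriv ^^ k) (\<lambda>z. z) 0"
      by (rule higher_deriv_diff[OF hol]) (auto intro!: holomorphic_intros)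
    moreover have "(deriv ^^ k) (\<lambda>z. f z - z) 0 = 0"
      by (rule higher_deriv_power_mult_0[OF h, where m = "Suc n"])
        (use f that in \<open>auto simp: algebra_simps\<close>)
    ultimately show ?thesis by simp
  qed
  show ?thesis
    using hol f[of 0] *[of 1] * assms(1) by (auto simp: classA_def)
qed

lemma classP_factor:
  assumes p: "p \<in> classP n"
  obtains h where "h holomorphic_on ball 0 1" "\<And>z. z \<in> ball 0 1 \<Longrightarrow> p z = 1 + z ^ n * h z"
proof -
  have hol: "p holomorphic_on ball 0 1" using p by (simp add: classP_def)
  then have hol': "(\<lambda>z. p z - 1) holomorphic_on ball 0 1" by (intro holomorphic_intros)
  have "(deriv ^^ k) (\<lambda>z. p z - 1) 0 = 0" if "k < n" for k
  proof -
    have "(deriv ^^ k) (\<lambda>z. p z - 1) 0 = (deriv ^^ k) p 0 - (deriv ^^ k) (\<lambda>z. 1) 0"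
      by (rule higher_deriv_diff[OF hol]) (auto intro!: holomorphic_intros)
    then show ?thesis using p that by (cases "k = 0") (auto simp: classP_def)
  qed
  then obtain h where h: "h holomorphic_on ball 0 1" "\<And>z. z \<in> ball 0 1 \<Longrightarrow> p z - 1 = z ^ n * h z"
    using holomorphic_factor_power[OF hol' zero_less_one] by blast
  have "p z = 1 + z ^ n * h z" if "z \<in> ball 0 1" for z
    using h(2)[OF that] by (simp add: algebra_simps)
  then show ?thesis using that h(1) by blast
qed

lemma classP_I:
  assumes "1 \<le> n" and h: "h holomorphic_on ball 0 1"
    and p: "\<And>z. z \<in> ball 0 1 \<Longrightarrow> p z = 1 + z ^ n * h z"
    and pos: "\<And>z. z \<in> ball 0 1 \<Longrightarrow> Re (p z) > 0"
  shows "p \<in> classP n"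
proof -
  have "p holomorphic_on ball 0 1 \<longleftrightarrow> (\<lambda>z. 1 + z ^ n * h z) holomorphic_on ball 0 1"
    by (rule holomorphic_cong) (use p in auto)
  then have hol: "p holomorphic_on ball 0 1" using h by (auto intro!: holomorphic_intros)
  have "(deriv ^^ k) p 0 = 0" if "1 \<le> k" "k < n" for k
  proof -
    have "(deriv ^^ k) (\<lambda>z. p z - 1) 0 = (deriv ^^ k) p 0 - (deriv ^^ k) (\<lambda>z. 1) 0"
      by (rule higher_deriv_diff[OF hol]) (auto intro!: holomorphic_intros)
    moreover have "(deriv ^^ k) (\<lambda>z. p z - 1) 0 = 0"
      by (rule higher_deriv_power_mult_0[OF h, where m = n]) (use p that in auto)
    ultimately show ?thesis using that by simp
  qed
  then show ?thesis
    using hol p[of 0] pos assms(1) by (auto simp: classP_def)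
qed

text \<open>With \<open>f = z * G\<close> and \<open>G = 1 + z ^ n * h\<close>, the quotient is
  \<open>1 + z * G' / G\<close>, and \<open>z * G'\<close> equals
  \<open>z ^ n * (n * h + z * h')\<close>. As \<open>G\<close> has no zeros, also not at 0, the
  singularity at the origin is removed and the order \<open>n\<close> is kept.\<close>

lemma logd_factor:
  assumes f: "f \<in> classA n" and n: "1 \<le> n" and nz: "\<And>z. z \<in> ball 0 1 \<Longrightarrow> z \<noteq> 0 \<Longrightarrow> f z \<noteq> 0"
  obtains k where "k holomorphic_on ball 0 1" "\<And>z. z \<in> ball 0 1 \<Longrightarrow> logd f z = 1 + z ^ n * k z"
proof -
  obtain h where h: "h holomorphic_on ball 0 1"
    and fh: "\<And>z. z \<in> ball 0 1 \<Longrightarrow> f z = z * (1 + z ^ n * h z)"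
    using classA_factor[OF f] by blast
  define k where "k = (\<lambda>z. (of_nat n * h z + z * deriv h z) / (1 + z ^ n * h z))"
  have Gnz: "1 + z ^ n * h z \<noteq> 0" if "z \<in> ball 0 1" for z
    using nz[OF that] fh[OF that] n by (cases "z = 0") (auto simp: power_0_left)
  have "k holomorphic_on ball 0 1"
    unfolding k_def using h Gnz by (intro holomorphic_intros) auto
  moreover have "logd f z = 1 + z ^ n * k z" if z: "z \<in> ball 0 1" for z
  proof (cases "z = 0")
    case True
    then show ?thesis using n by (simp add: logd_def)
  next
    case False
    have dh: "(h has_field_derivative deriv h z) (at z)"
      using h z by (intro holomorphic_derivI[where S = "ball 0 1"]) auto
    have "((\<lambda>z. z * (1 + z ^ n * h z)) has_field_derivative
        1 * (1 + z ^ n * h z) + (of_nat n * z ^ (n - 1) * h z + z ^ n * deriv h z) * z) (at z)"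
      by (rule derivative_eq_intros dh refl | simp)+
    moreover have "1 * (1 + z ^ n * h z) + (of_nat n * z ^ (n - 1) * h z + z ^ n * deriv h z) * z =
        (1 + z ^ n * h z) + z ^ n * (of_nat n * h z + z * deriv h z)"
      using n by (cases n) (auto simp: algebra_simps)
    ultimately have "((\<lambda>z. z * (1 + z ^ n * h z)) has_field_derivative
        (1 + z ^ n * h z) + z ^ n * (of_nat n * h z + z * deriv h z)) (at z)" by simp
    then have "(f has_field_derivative
        (1 + z ^ n * h z) + z ^ n * (of_nat n * h z + z * deriv h z)) (at z)"
      by (rule has_field_derivative_transform_within_open[where S = "ball 0 1"]) (use fh z in auto)
    then have "deriv f z = (1 + z ^ n * h z) + z ^ n * (of_nat n * h z + z * deriv h z)"
      by (rule DERIV_imp_deriv)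
    then have "logd f z = ((1 + z ^ n * h z) + z ^ n * (of_nat n * h z + z * deriv h z)) / (1 + z ^ n * h z)"
      using False fh[OF z] by (simp add: logd_def)
    then show ?thesis using Gnz[OF z] by (simp add: k_def divide_simps)
  qed
  ultimately show ?thesis using that by blast
qed

section \<open>Disks containing the values of \<open>q\<close> and of
  \<open>z p' / p\<close>\<close>

text \<open>The map \<open>w / (1 - w)\<close> sends the disk of radius \<open>R\<close> to the disk
  with real diameter from \<open>- R / (1 + R)\<close> to \<open>R / (1 - R)\<close>. After clearing
  denominators and squaring, the claim is \<open>(R^2 - |w|^2) * (1 - R^2) >= 0\<close>.\<close>

lemma norm_Cayley_diff_le:
  fixes w :: complex
  assumes w: "norm w \<le> R" and R: "R < 1"
  shows "norm (w / (1 - w) - of_real (R\<^sup>2 / (1 - R\<^sup>2))) \<le> R / (1 - R\<^sup>2)"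
proof -
  have R0: "0 \<le> R" using w norm_ge_zero order_trans by blast
  have R2: "R\<^sup>2 < 1" using R R0 by (simp add: abs_square_less_1)
  have w1: "1 - w \<noteq> 0" using w R by auto
  have "(norm w)\<^sup>2 \<le> R\<^sup>2" using w by (simp add: power_mono)
  then have "0 \<le> (R\<^sup>2 - (norm w)\<^sup>2) * (1 - R\<^sup>2)" using R2 by simp
  also have "\<dots> = (R * norm (1 - w))\<^sup>2 - (norm (w - of_real (R\<^sup>2)))\<^sup>2"
    unfolding power_mult_distrib cmod_power2 by (simp, algebra)
  finally have "norm (w - of_real (R\<^sup>2)) \<le> R * norm (1 - w)"
    using R0 by (intro power2_le_imp_le[of "norm (w - of_real (R\<^sup>2))"]) auto
  moreover have "w / (1 - w) - of_real (R\<^sup>2 / (1 - R\<^sup>2)) = (w - of_real (R\<^sup>2)) / ((1 - w) * of_real (1 - R\<^sup>2))"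
  proof -
    have "1 - (of_real (R\<^sup>2) :: complex) \<noteq> 0"
      using R2 by (metis less_irrefl of_real_1 of_real_eq_iff right_minus_eq)
    then show ?thesis using w1 by (simp add: divide_simps) (simp add: algebra_simps)
  qed
  ultimately show ?thesis
    using R2 w1 by (simp add: norm_divide norm_mult divide_simps del: of_real_diff of_real_power)
qed

text \<open>Solving \<open>q = 1 + 2 * (1 - \<alpha>) * w / (1 - w)\<close> for \<open>w\<close>
  gives \<open>(q - 1) / (q + 1 - 2 * \<alpha>)\<close>, bounded by 1 on the disk and divisible by
  \<open>z ^ n\<close>. Hence \<open>norm w \<le> R\<close>, and \<open>norm_Cayley_diff_le\<close>
  applies.\<close>

lemma Re_gt_imp_norm_diff_le:
  fixes q k :: "complex \<Rightarrow> complex" and \<alpha> :: real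
  assumes n: "1 \<le> n" and \<alpha>: "\<alpha> < 1" and k: "k holomorphic_on ball 0 1"
    and q: "\<And>z. z \<in> ball 0 1 \<Longrightarrow> q z = 1 + z ^ n * k z"
    and Re: "\<And>z. z \<in> ball 0 1 \<Longrightarrow> Re (q z) > \<alpha>"
    and z: "z \<in> ball 0 1"
  defines "R \<equiv> norm z ^ n"
  shows "norm (q z - 1 - of_real (2 * (1 - \<alpha>) * R\<^sup>2 / (1 - R\<^sup>2))) \<le> 2 * (1 - \<alpha>) * R / (1 - R\<^sup>2)"
proof -
  \<comment> \<open>The denominator \<open>q + 1 - 2 * \<alpha>\<close>, written through
    \<open>k\<close> so that its holomorphy is visible.\<close>
  define D where "D = (\<lambda>z. 2 * of_real (1 - \<alpha>) + z ^ n * k z)"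
  have D: "D z = q z + 1 - 2 * of_real \<alpha>" if "z \<in> ball 0 1" for z
    using q[OF that] by (simp add: D_def)
  have Dnz: "D z \<noteq> 0" if "z \<in> ball 0 1" for z
  proof
    assume "D z = 0"
    then have "Re (q z + 1 - 2 * of_real \<alpha>) = 0" using D[OF that] by simp
    then show False using Re[OF that] \<alpha> by simp
  qed
  define \<phi> where "\<phi> = (\<lambda>z. k z / D z)"
  have hol: "\<phi> holomorphic_on ball 0 1"
    unfolding \<phi>_def using Dnz by (intro holomorphic_intros k) (auto simp: D_def intro!: holomorphic_intros k)
  have w: "z ^ n * \<phi> z = (q z - 1) / D z" if "z \<in> ball 0 1" for z
    using q[OF that] by (simp add: \<phi>_def)
  have le: "norm (z ^ n * \<phi> z) \<le> 1" if "z \<in> ball 0 1" for z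
  proof -
    \<comment> \<open>Four times this product is \<open>|D z|^2 - |q z - 1|^2\<close>.\<close>
    have "0 \<le> (1 - \<alpha>) * (Re (q z) - \<alpha>)" using Re[OF that] \<alpha> by simp
    then have "(norm (q z - 1))\<^sup>2 \<le> (norm (D z))\<^sup>2"
      unfolding D[OF that] cmod_power2 by (simp add: power2_eq_square algebra_simps)
    then have "norm (q z - 1) \<le> norm (D z)" by (rule power2_le_imp_le) simp
    then show ?thesis using Dnz[OF that] by (simp add: w[OF that] norm_divide)
  qed
  define w where "w = z ^ n * \<phi> z"
  have "norm (\<phi> z) \<le> 1" by (rule norm_le_1_of_power_mult[OF hol le z])
  then have wR: "norm w \<le> R"
    by (simp add: w_def R_def norm_mult norm_power mult_left_le)
  have R1: "R < 1" using z n by (simp add: R_def power_less_one_iff)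
  have w1: "1 - w \<noteq> 0" using wR R1 by auto
  have "w * D z = q z - 1" using w[OF z] Dnz[OF z] by (simp add: w_def)
  then have "q z - 1 = of_real (2 * (1 - \<alpha>)) * (w / (1 - w))"
    using w1 unfolding D[OF z] by (simp add: divide_simps) (simp add: algebra_simps)
  then have "q z - 1 - of_real (2 * (1 - \<alpha>) * R\<^sup>2 / (1 - R\<^sup>2)) =
      of_real (2 * (1 - \<alpha>)) * (w / (1 - w) - of_real (R\<^sup>2 / (1 - R\<^sup>2)))"
    by (simp add: algebra_simps)
  then have "norm (q z - 1 - of_real (2 * (1 - \<alpha>) * R\<^sup>2 / (1 - R\<^sup>2))) =
      2 * (1 - \<alpha>) * norm (w / (1 - w) - of_real (R\<^sup>2 / (1 - R\<^sup>2)))"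
    using \<alpha> by (simp only: norm_mult norm_of_real) simp
  also have "\<dots> \<le> 2 * (1 - \<alpha>) * (R / (1 - R\<^sup>2))"
    using \<alpha> by (intro mult_left_mono norm_Cayley_diff_le wR R1) auto
  finally show ?thesis by simp
qed

text \<open>Pairs the odd powers \<open>r ^ (2 k + 1)\<close> with those of complementary exponent and uses
  \<open>(1 - r ^ a) (1 - r ^ b) \<ge> 0\<close>.\<close>
lemma two_sum_odd_powers_le:
  fixes r :: real
  assumes "0 \<le> r" "r \<le> 1"
  shows "2 * (\<Sum>k<n. r ^ (2 * k + 1)) \<le> real n * (1 + r ^ (2 * n))"
proof -
  have "(\<Sum>k<n. r ^ (2 * k + 1)) = (\<Sum>k<n. r ^ (2 * (n - Suc k) + 1))"
    by (rule sum.nat_diff_reindex[symmetric])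
  then have "2 * (\<Sum>k<n. r ^ (2 * k + 1)) = (\<Sum>k<n. r ^ (2 * k + 1) + r ^ (2 * (n - Suc k) + 1))"
    by (simp add: sum.distrib)
  also have "\<dots> \<le> (\<Sum>k<n. 1 + r ^ (2 * n))"
  proof (rule sum_mono)
    fix k assume k: "k \<in> {..<n}"
    define a b where "a = r ^ (2 * k + 1)" and "b = r ^ (2 * (n - Suc k) + 1)"
    have "a \<le> 1" "b \<le> 1" using assms unfolding a_def b_def by (intro power_le_one; simp)+
    then have "0 \<le> (1 - a) * (1 - b)" by simp
    moreover have "2 * k + 1 + (2 * (n - Suc k) + 1) = 2 * n" using k by auto
    then have "a * b = r ^ (2 * n)" unfolding a_def b_def by (metis power_add)
    ultimately show "a + b \<le> 1 + r ^ (2 * n)" by (simp add: algebra_simps)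
  qed
  finally show ?thesis by simp
qed

text \<open>The real inequality behind a Schwarz--Pick lemma for
  \<open>w = z ^ n * \<phi> z\<close>, with \<open>r\<close>, \<open>t\<close>, \<open>d\<close> the
  moduli of \<open>z\<close>, of \<open>\<phi> z\<close> and of its derivative. The geometric sum
  \<open>S\<close> trades \<open>1 - r^2\<close> for \<open>1 - r ^ (2 * n)\<close>; removing the
  factors \<open>r ^ n\<close> and \<open>1 - t\<close> leaves
  \<open>S * (1 + t) \<le> n * (1 + P * t)\<close>.\<close>

lemma power_mult_deriv_bound:
  fixes r t d :: real
  assumes r: "0 \<le> r" "r < 1" and t: "0 \<le> t" "t \<le> 1" and d: "d * (1 - r\<^sup>2) \<le> 1 - t\<^sup>2"
  shows "(real n * r ^ n * t + r ^ Suc n * d) * (1 - (r ^ n)\<^sup>2) \<le> real n * r ^ n * (1 - (r ^ n * t)\<^sup>2)"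
proof -
  define S where "S = (\<Sum>k<n. r ^ (2 * k + 1))"
  define P where "P = r ^ (2 * n)"
  have P: "(r ^ n)\<^sup>2 = P" by (simp add: P_def power_mult[symmetric] mult.commute)
  have S0: "0 \<le> S" using r by (auto simp: S_def intro!: sum_nonneg)
  have "S \<le> (\<Sum>k<n. 1)" unfolding S_def using r by (intro sum_mono power_le_one) auto
  then have Sn: "S \<le> real n" by simp
  have S2: "2 * S \<le> real n * (1 + P)"
    unfolding S_def P_def by (rule two_sum_odd_powers_le) (use r in auto)
  have geo: "r * (1 - P) = (1 - r\<^sup>2) * S"
  proof -
    have "S = r * (\<Sum>k<n. (r\<^sup>2) ^ k)"
      by (simp add: S_def sum_distrib_left power_mult)
    moreover have "1 - P = (1 - r\<^sup>2) * (\<Sum>k<n. (r\<^sup>2) ^ k)"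
      unfolding P_def power_mult by (rule one_diff_power_eq)
    ultimately show ?thesis by (simp add: mult_ac)
  qed
  \<comment> \<open>Both sides of the target are affine in \<open>t\<close>, so the cases
    \<open>t = 0\<close> and \<open>t = 1\<close>, namely \<open>Sn\<close> and \<open>S2\<close>,
    suffice.\<close>
  have "S * (1 + t) = S * (1 - t) + 2 * S * t" by (simp add: algebra_simps)
  also have "\<dots> \<le> real n * (1 - t) + real n * (1 + P) * t"
    using Sn S2 t by (intro add_mono mult_right_mono) auto
  finally have "S * (1 + t) \<le> real n * (1 + P * t)" by (simp add: algebra_simps)
  then have "S * (1 + t) * (1 - t) \<le> real n * (1 + P * t) * (1 - t)"
    using t by (intro mult_right_mono) auto
  then have "S * (1 - t\<^sup>2) \<le> real n * (1 - t) * (1 + P * t)"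
    by (simp add: algebra_simps power2_eq_square)
  moreover have "S * (d * (1 - r\<^sup>2)) \<le> S * (1 - t\<^sup>2)"
    using d S0 by (intro mult_left_mono)
  ultimately have "d * ((1 - r\<^sup>2) * S) \<le> real n * (1 - t) * (1 + P * t)" by (simp add: mult_ac)
  then have "real n * t * (1 - P) + d * (r * (1 - P)) \<le> real n * (1 - P * t\<^sup>2)"
    unfolding geo by (simp add: algebra_simps power2_eq_square)
  then have "r ^ n * (real n * t * (1 - P) + d * (r * (1 - P))) \<le> r ^ n * (real n * (1 - P * t\<^sup>2))"
    using r by (intro mult_left_mono) auto
  then show ?thesis unfolding power_mult_distrib P by (simp add: algebra_simps)
qed

text \<open>Writing \<open>p = (1 + w) / (1 - w)\<close> with \<open>w = z ^ n * \<phi> z\<close>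
  gives \<open>z * p' / p = 2 * z * w' / (1 - w^2)\<close>. The numerator is controlled by
  \<open>power_mult_deriv_bound\<close>, the denominator by \<open>1 - |w|^2\<close>.\<close>

lemma norm_log_deriv_le:
  fixes p k :: "complex \<Rightarrow> complex"
  assumes n: "1 \<le> n" and k: "k holomorphic_on ball 0 1"
    and p: "\<And>z. z \<in> ball 0 1 \<Longrightarrow> p z = 1 + z ^ n * k z"
    and Re: "\<And>z. z \<in> ball 0 1 \<Longrightarrow> Re (p z) > 0"
    and z: "z \<in> ball 0 1"
  defines "R \<equiv> norm z ^ n"
  shows "norm (z * deriv p z / p z) \<le> 2 * real n * R / (1 - R\<^sup>2)"
proof -
  define \<phi> where "\<phi> = (\<lambda>z. k z / (2 + z ^ n * k z))"
  have nz: "2 + z ^ n * k z \<noteq> 0" "p z \<noteq> 0" if "z \<in> ball 0 1" for z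
  proof -
    have "Re (2 + z ^ n * k z) > 0" using p[OF that] Re[OF that] by simp
    then show "2 + z ^ n * k z \<noteq> 0" by (metis less_irrefl zero_complex.simps(1))
    show "p z \<noteq> 0" using Re[OF that] by auto
  qed
  have hol: "\<phi> holomorphic_on ball 0 1"
    unfolding \<phi>_def using nz by (intro holomorphic_intros k) auto
  have w: "z ^ n * \<phi> z = (p z - 1) / (p z + 1)" if "z \<in> ball 0 1" for z
    using p[OF that] by (simp add: \<phi>_def)
  have p1: "p z + 1 \<noteq> 0" if "z \<in> ball 0 1" for z
    using nz(1)[OF that] p[OF that] by simp
  have le: "norm (z ^ n * \<phi> z) \<le> 1" if "z \<in> ball 0 1" for z
  proof -
    have "(norm (p z - 1))\<^sup>2 \<le> (norm (p z + 1))\<^sup>2"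
      unfolding cmod_power2 using Re[OF that] by (simp add: power2_eq_square algebra_simps)
    then have "norm (p z - 1) \<le> norm (p z + 1)" by (rule power2_le_imp_le) simp
    then show ?thesis using p1[OF that] by (simp add: w[OF that] norm_divide)
  qed
  have \<phi>1: "norm (\<phi> z) \<le> 1" if "z \<in> ball 0 1" for z
    by (rule norm_le_1_of_power_mult[OF hol le that])
  define r t d where "r = norm z" and "t = norm (\<phi> z)" and "d = norm (deriv \<phi> z)"
  have r: "0 \<le> r" "r < 1" and t: "0 \<le> t" "t \<le> 1" using z \<phi>1 by (auto simp: r_def t_def)
  have R: "R = r ^ n" "0 \<le> R" "R < 1" using r n by (auto simp: R_def r_def power_less_one_iff)
  have d: "d * (1 - r\<^sup>2) \<le> 1 - t\<^sup>2"
    unfolding d_def r_def t_def by (rule Schwarz_Pick[OF hol \<phi>1 z])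
  have bound: "(real n * R * t + R * r * d) * (1 - R\<^sup>2) \<le> real n * R * (1 - (R * t)\<^sup>2)"
    using power_mult_deriv_bound[OF r t d, of n] by (simp add: R mult_ac)
  define w where "w = z ^ n * \<phi> z"
  define w' where "w' = of_nat n * z ^ (n - 1) * \<phi> z + z ^ n * deriv \<phi> z"
  have zw': "z * w' = of_nat n * z ^ n * \<phi> z + z ^ n * z * deriv \<phi> z"
    using n by (simp add: w'_def algebra_simps power_eq_if)
  have d\<phi>: "(\<phi> has_field_derivative deriv \<phi> z) (at z)"
    using hol z by (intro holomorphic_derivI[where S = "ball 0 1"]) auto
  have dw: "((\<lambda>z. z ^ n * \<phi> z) has_field_derivative w') (at z)"
    unfolding w'_def by (rule derivative_eq_intros d\<phi> refl | simp)+
  have wn: "norm w = R * t" by (simp add: w_def R r_def t_def norm_mult norm_power)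
  have "R * t < 1" using R t mult_left_le[of t R] by linarith
  then have w1: "1 - w \<noteq> 0" "1 + w \<noteq> 0"
  proof -
    show "1 - w \<noteq> 0" using \<open>R * t < 1\<close> wn by auto
    show "1 + w \<noteq> 0"
    proof
      assume "1 + w = 0"
      then have "w = -1" by (simp add: add_eq_0_iff)
      then show False using \<open>R * t < 1\<close> wn by simp
    qed
  qed
  have peq: "p z = (1 + z ^ n * \<phi> z) / (1 - z ^ n * \<phi> z)" if "z \<in> ball 0 1" for z
    unfolding w[OF that] using p1[OF that] by (simp add: divide_simps)
  have "((\<lambda>z. (1 + z ^ n * \<phi> z) / (1 - z ^ n * \<phi> z)) has_field_derivative 2 * w' / (1 - w)\<^sup>2) (at z)"
    using w1 unfolding w_def
    by - (rule derivative_eq_intros dw refl | simp add: power2_eq_square algebra_simps)+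
  then have "(p has_field_derivative 2 * w' / (1 - w)\<^sup>2) (at z)"
    by (rule has_field_derivative_transform_within_open[where S = "ball 0 1"]) (use peq z in auto)
  then have "deriv p z = 2 * w' / (1 - w)\<^sup>2" by (rule DERIV_imp_deriv)
  moreover have "p z = (1 + w) / (1 - w)" using peq[OF z] by (simp add: w_def)
  moreover have "2 * w' / (1 - w)\<^sup>2 / ((1 + w) / (1 - w)) = 2 * w' / ((1 - w) * (1 + w))"
    using w1 by (simp add: power2_eq_square)
  moreover have "(1 - w) * (1 + w) = 1 - w\<^sup>2" by (simp add: power2_eq_square algebra_simps)
  ultimately have "z * deriv p z / p z = 2 * (z * w') / (1 - w\<^sup>2)"
    by (metis (no_types, opaque_lifting) mult.left_commute times_divide_eq_right)
  then have "norm (z * deriv p z / p z) = 2 * norm (z * w') / norm (1 - w\<^sup>2)"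
    by (simp add: norm_divide norm_mult)
  also have "\<dots> \<le> 2 * (real n * R * t + R * r * d) / (1 - (R * t)\<^sup>2)"
  proof (rule frac_le)
    show "2 * norm (z * w') \<le> 2 * (real n * R * t + R * r * d)"
      unfolding zw' by (rule mult_left_mono, rule norm_triangle_le)
        (simp_all add: norm_mult norm_power R r_def t_def d_def)
    show "0 < 1 - (R * t)\<^sup>2" using \<open>R * t < 1\<close> R t by (simp add: abs_square_less_1)
    show "1 - (R * t)\<^sup>2 \<le> norm (1 - w\<^sup>2)"
      using norm_triangle_ineq2[of 1 "w\<^sup>2"] wn by (simp add: norm_power)
    show "0 \<le> 2 * (real n * R * t + R * r * d)" using R r t by (simp add: d_def)
  qed
  \<comment> \<open>The unknown \<open>t\<close> disappears here: \<open>bound\<close> carries the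
    same factor \<open>1 - (R * t)^2\<close> as the denominator.\<close>
  also have "\<dots> \<le> 2 * real n * R / (1 - R\<^sup>2)"
  proof -
    have "0 < 1 - (R * t)\<^sup>2" using \<open>R * t < 1\<close> R t by (simp add: abs_square_less_1)
    moreover have "0 < 1 - R\<^sup>2" using R by (simp add: abs_square_less_1)
    moreover have "2 * (real n * R * t + R * r * d) * (1 - R\<^sup>2) \<le> 2 * real n * R * (1 - (R * t)\<^sup>2)"
      using bound by (simp only: mult.assoc)
    ultimately show ?thesis by (simp only: pos_divide_le_eq pos_le_divide_eq times_divide_eq_left)
  qed
  finally show ?thesis .
qed

subsection \<open>Radius estimate and extremal function\<close>

text \<open>Division by zero yields 0, so at a zero of \<open>g\<close> away from the origin
  \<open>logd g\<close> would be 0, whose real part does not exceed \<alpha>.\<close>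

lemma starlike_n_nonzero:
  assumes "g \<in> starlike_n n \<alpha>" "0 \<le> \<alpha>" "z \<in> ball 0 1" "z \<noteq> 0"
  shows "g z \<noteq> 0"
proof
  assume "g z = 0"
  then have "Re (logd g z) = 0" using assms(4) by (simp add: logd_def)
  then show False using assms(1,2,3) by (force simp: starlike_n_def)
qed

text \<open>At a zero of \<open>f\<close> away from the origin \<open>quot0 f g\<close> is 0
  whatever the value of \<open>g\<close>, against positivity of its real part.\<close>

lemma CS_n_nonzero:
  assumes "f \<in> CS_n n \<alpha>" "z \<in> ball 0 1" "z \<noteq> 0"
  shows "f z \<noteq> 0"
proof
  assume "f z = 0"
  obtain g where "quot0 f g \<in> classP n" using assms(1) by (auto simp: CS_n_def)
  then have "Re (quot0 f g z) > 0" using assms(2) by (simp add: classP_def)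
  then show False using \<open>f z = 0\<close> assms(3) by (simp add: quot0_def)
qed

text \<open>From \<open>f = g * p\<close> the logarithmic derivatives add. The starlike part
  supplies the centre, the part from \<open>p\<close> is a disk around 0, and the two radii
  sum.\<close>

lemma CS_n_norm_logd_diff_le:
  assumes f: "f \<in> CS_n n \<alpha>" and n: "1 \<le> n" and \<alpha>: "0 \<le> \<alpha>" "\<alpha> < 1" and z: "z \<in> ball 0 1"
  defines "R \<equiv> norm z ^ n"
  shows "norm (logd f z - 1 - of_real (2 * (1 - \<alpha>) * R\<^sup>2 / (1 - R\<^sup>2))) \<le> 2 * (1 + real n - \<alpha>) * R / (1 - R\<^sup>2)"
proof -
  obtain g where g: "g \<in> starlike_n n \<alpha>" and p: "quot0 f g \<in> classP n"
    using f by (auto simp: CS_n_def)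
  have gA: "g \<in> classA n" and gRe: "\<And>z. z \<in> ball 0 1 \<Longrightarrow> Re (logd g z) > \<alpha>"
    using g by (auto simp: starlike_n_def)
  have hg: "g holomorphic_on ball 0 1" and hp: "quot0 f g holomorphic_on ball 0 1"
    and f0: "f 0 = 0" and g0: "g 0 = 0"
    using f gA p by (auto simp: CS_n_def classA_def classP_def)
  have pRe: "\<And>z. z \<in> ball 0 1 \<Longrightarrow> Re (quot0 f g z) > 0" using p by (simp add: classP_def)
  note gnz = starlike_n_nonzero[OF g \<alpha>(1)]
  obtain k where k: "k holomorphic_on ball 0 1" "\<And>z. z \<in> ball 0 1 \<Longrightarrow> logd g z = 1 + z ^ n * k z"
    using logd_factor[OF gA n gnz] by blast
  obtain l where l: "l holomorphic_on ball 0 1" "\<And>z. z \<in> ball 0 1 \<Longrightarrow> quot0 f g z = 1 + z ^ n * l z"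
    using classP_factor[OF p] by blast
  define c where "c = complex_of_real (2 * (1 - \<alpha>) * R\<^sup>2 / (1 - R\<^sup>2))"
  have eq: "logd f z = logd g z + z * deriv (quot0 f g) z / quot0 f g z"
  proof (cases "z = 0")
    case False
    have fgp: "g w * quot0 f g w = f w" if "w \<in> ball 0 1" for w
      using gnz[OF that] f0 g0 by (simp add: quot0_def)
    have "((\<lambda>w. g w * quot0 f g w) has_field_derivative
        deriv g z * quot0 f g z + g z * deriv (quot0 f g) z) (at z)"
      using DERIV_mult[OF holomorphic_derivI[OF hg _ z] holomorphic_derivI[OF hp _ z]]
      by (simp add: mult.commute)
    then have "(f has_field_derivative deriv g z * quot0 f g z + g z * deriv (quot0 f g) z) (at z)"
      by (rule has_field_derivative_transform_within_open[where S = "ball 0 1"]) (use fgp z in auto)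
    then have "deriv f z = deriv g z * quot0 f g z + g z * deriv (quot0 f g) z"
      by (rule DERIV_imp_deriv)
    moreover have "quot0 f g z \<noteq> 0" using pRe[OF z] by auto
    ultimately show ?thesis
      using False gnz[OF z False] unfolding logd_def
      by (simp add: fgp[OF z, symmetric] divide_simps) (simp add: algebra_simps)
  qed (simp add: logd_def)
  have "norm (logd f z - 1 - c) \<le> norm (logd g z - 1 - c) + norm (z * deriv (quot0 f g) z / quot0 f g z)"
    using norm_triangle_ineq[of "logd g z - 1 - c" "z * deriv (quot0 f g) z / quot0 f g z"]
    by (simp add: eq algebra_simps)
  also have "\<dots> \<le> 2 * (1 - \<alpha>) * R / (1 - R\<^sup>2) + 2 * real n * R / (1 - R\<^sup>2)"
    unfolding c_def R_def
    by (intro add_mono Re_gt_imp_norm_diff_le[OF n \<alpha>(2) k gRe z] norm_log_deriv_le[OF n l pRe z])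
  also have "\<dots> = 2 * (1 + real n - \<alpha>) * R / (1 - R\<^sup>2)"
    by (simp add: algebra_simps flip: add_divide_distrib)
  finally show ?thesis by (simp add: c_def)
qed

section \<open>Subordination and dilation\<close>

text \<open>Since \<open>z * exp z\<close> is univalent, composing its inverse with
  \<open>F - 1\<close> gives the Schwarz function, so subordination reduces to inclusion of
  values.\<close>

lemma subord_wpI:
  assumes F: "F holomorphic_on ball 0 1" "F 0 = 1"
    and sub: "\<And>z. z \<in> ball 0 1 \<Longrightarrow> F z - 1 \<in> (\<lambda>z. z * exp z) ` ball 0 1"
  shows "subord F wp"
proof -
  let ?f = "\<lambda>z::complex. z * exp z"
  have hol: "?f holomorphic_on ball 0 1" by (intro holomorphic_intros)
  obtain g where g: "g holomorphic_on ?f ` ball 0 1" "\<And>z. z \<in> ball 0 1 \<Longrightarrow> g (?f z) = z"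
    by (rule holomorphic_has_inverse[OF hol open_ball inj_on_mult_exp]) (rule that; simp)
  have gf: "g (F z - 1) \<in> ball 0 1 \<and> ?f (g (F z - 1)) = F z - 1" if "z \<in> ball 0 1" for z
    using sub[OF that] g(2) by auto
  show ?thesis
    unfolding subord_def
  proof (intro exI[of _ "\<lambda>z. g (F z - 1)"] conjI ballI)
    have "(g \<circ> (\<lambda>z. F z - 1)) holomorphic_on ball 0 1"
      by (rule holomorphic_on_compose_gen[OF _ g(1)]) (use F sub in \<open>auto intro!: holomorphic_intros\<close>)
    then show "(\<lambda>z. g (F z - 1)) holomorphic_on ball 0 1" by (simp add: o_def)
    show "g (F 0 - 1) = 0" using g(2)[of 0] F by simp
    show "F z = wp (g (F z - 1))" if "z \<in> ball 0 1" for z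
      using gf[OF that] by (simp add: wp_def)
  qed (use gf in auto)
qed

lemma subord_wp_imp_mem:
  assumes "subord F wp" "z \<in> ball 0 1"
  shows "F z - 1 \<in> (\<lambda>z. z * exp z) ` ball 0 1"
  using assms by (force simp: subord_def wp_def)

lemma of_real_mult_in_ball:
  assumes "0 < r" "r \<le> 1" "z \<in> ball 0 1"
  shows "of_real r * z \<in> ball (0::complex) 1"
  using assms mult_le_one[of r "norm z"] mult_left_le_one_le[of "norm z" r]
  by (simp add: norm_mult)

lemma holomorphic_on_of_real_mult:
  assumes "f holomorphic_on ball (0::complex) 1" "0 < r" "r \<le> 1"
  shows "(\<lambda>z. f (of_real r * z)) holomorphic_on ball 0 1"
proof -
  have "(f \<circ> (\<lambda>z. of_real r * z)) holomorphic_on ball 0 1"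
    by (rule holomorphic_on_compose_gen[OF _ assms(1)])
      (use assms(2,3) of_real_mult_in_ball in \<open>auto intro!: holomorphic_intros\<close>)
  then show ?thesis by (simp add: o_def)
qed

lemma dilate_classA:
  assumes f: "f \<in> classA n" and n: "1 \<le> n" and r: "0 < r" "r \<le> 1"
  shows "dilate r f \<in> classA n"
proof -
  obtain h where h: "h holomorphic_on ball 0 1" "\<And>z. z \<in> ball 0 1 \<Longrightarrow> f z = z * (1 + z ^ n * h z)"
    using classA_factor[OF f] by blast
  show ?thesis
  proof (rule classA_I[OF n])
    show "(\<lambda>z. of_real r ^ n * h (of_real r * z)) holomorphic_on ball 0 1"
      by (intro holomorphic_intros holomorphic_on_of_real_mult h(1) r)
    show "dilate r f z = z * (1 + z ^ n * (of_real r ^ n * h (of_real r * z)))" if "z \<in> ball 0 1" for z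
      using h(2)[OF of_real_mult_in_ball[OF r that]] r by (simp add: dilate_def power_mult_distrib mult_ac)
  qed
qed

lemma logd_dilate:
  assumes f: "f holomorphic_on ball 0 1" and r: "0 < r" "r \<le> 1" and z: "z \<in> ball 0 1"
  shows "logd (dilate r f) z = logd f (of_real r * z)"
proof -
  have "(f has_field_derivative deriv f (of_real r * z)) (at (of_real r * z))"
    by (rule holomorphic_derivI[OF f open_ball of_real_mult_in_ball[OF r z]])
  moreover have "((\<lambda>z. of_real r * z) has_field_derivative of_real r) (at z)"
    by (auto intro!: derivative_eq_intros)
  ultimately have "((\<lambda>z. f (of_real r * z)) has_field_derivative deriv f (of_real r * z) * of_real r) (at z)"
    by (rule DERIV_chain2)
  then have "(dilate r f has_field_derivative deriv f (of_real r * z) * of_real r / of_real r) (at z)"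
    unfolding dilate_def[abs_def] by (rule DERIV_cdivide)
  then have "deriv (dilate r f) z = deriv f (of_real r * z)"
    using r DERIV_imp_deriv by fastforce
  then show ?thesis using r by (simp add: logd_def dilate_def)
qed

lemma classA_subset_classA_1: "classA n \<subseteq> classA 1"
  by (auto simp: classA_def)

text \<open>Dilation only rescales the argument of \<open>logd f\<close>, and
  \<open>logd_factor\<close> makes \<open>logd f\<close> holomorphic through the origin; what
  remains is a pointwise condition on \<open>norm z < r\<close>.\<close>

lemma dilate_in_Swp_n:
  assumes f: "f \<in> classA n" and n: "1 \<le> n" and r: "0 < r" "r \<le> 1"
    and nz: "\<And>z. z \<in> ball 0 1 \<Longrightarrow> z \<noteq> 0 \<Longrightarrow> f z \<noteq> 0"
    and mem: "\<And>z. norm z < r \<Longrightarrow> logd f z - 1 \<in> (\<lambda>z. z * exp z) ` ball 0 1"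
  shows "dilate r f \<in> Swp_n n"
proof -
  have hf: "f holomorphic_on ball 0 1" using f by (simp add: classA_def)
  obtain k where k: "k holomorphic_on ball 0 1" "\<And>z. z \<in> ball 0 1 \<Longrightarrow> logd f z = 1 + z ^ n * k z"
    using logd_factor[OF f n nz] by blast
  have "logd f holomorphic_on ball 0 1 \<longleftrightarrow> (\<lambda>z. 1 + z ^ n * k z) holomorphic_on ball 0 1"
    by (rule holomorphic_cong) (use k in auto)
  then have hl: "logd f holomorphic_on ball 0 1" using k(1) by (auto intro!: holomorphic_intros)
  have "logd (dilate r f) holomorphic_on ball 0 1 \<longleftrightarrow> (\<lambda>z. logd f (of_real r * z)) holomorphic_on ball 0 1"
    by (rule holomorphic_cong) (use logd_dilate[OF hf r] in auto)
  then have "logd (dilate r f) holomorphic_on ball 0 1"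
    using holomorphic_on_of_real_mult[OF hl r] by simp
  moreover have "logd (dilate r f) 0 = 1" by (simp add: logd_def)
  moreover have "logd (dilate r f) z - 1 \<in> (\<lambda>z. z * exp z) ` ball 0 1" if z: "z \<in> ball 0 1" for z
    unfolding logd_dilate[OF hf r z] by (rule mem) (use r z in \<open>simp add: norm_mult\<close>)
  ultimately have "subord (logd (dilate r f)) wp" by (rule subord_wpI)
  moreover have "dilate r f \<in> classA n" by (rule dilate_classA[OF f n r])
  ultimately show ?thesis using classA_subset_classA_1 by (auto simp: Swp_n_def Swp_def)
qed

section \<open>Functions of \<open>z ^ n\<close> and the extremal function\<close>

lemma holomorphic_unit_factor_power:
  assumes u: "u holomorphic_on ball 0 1" "u 0 = 1" and n: "1 \<le> n"
  obtains h where "h holomorphic_on ball 0 1" "\<And>z. z \<in> ball 0 1 \<Longrightarrow> u (z ^ n) = 1 + z ^ n * h z"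
proof -
  have "(\<lambda>w. u w - 1) holomorphic_on ball 0 1" using u(1) by (intro holomorphic_intros)
  then obtain l where l: "l holomorphic_on ball 0 1" "\<And>w. norm w < 1 \<Longrightarrow> u w - 1 = w * l w"
    by (rule Schwarz3) (use u in auto)
  have pow: "z ^ n \<in> ball 0 1" if "z \<in> ball (0::complex) 1" for z
    using that n by (simp add: norm_power power_less_one_iff)
  have "(l \<circ> (\<lambda>z. z ^ n)) holomorphic_on ball 0 1"
    by (rule holomorphic_on_compose_gen[OF _ l(1)]) (use pow in \<open>auto intro!: holomorphic_intros\<close>)
  moreover have "u (z ^ n) = 1 + z ^ n * (l \<circ> (\<lambda>z. z ^ n)) z" if "z \<in> ball 0 1" for z
    using l(2)[of "z ^ n"] pow[OF that] by (simp add: algebra_simps)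
  ultimately show ?thesis using that by blast
qed

lemma classA_mult_power:
  assumes "u holomorphic_on ball 0 1" "u 0 = 1" "1 \<le> n"
  shows "(\<lambda>z. z * u (z ^ n)) \<in> classA n"
proof -
  obtain h where "h holomorphic_on ball 0 1" "\<And>z. z \<in> ball 0 1 \<Longrightarrow> u (z ^ n) = 1 + z ^ n * h z"
    using holomorphic_unit_factor_power[OF assms] by blast
  then show ?thesis by (intro classA_I[OF assms(3), of h]) auto
qed

lemma logd_mult_power:
  assumes u: "(u has_field_derivative u') (at (z ^ n))" "u (z ^ n) \<noteq> 0" and n: "1 \<le> n"
  shows "logd (\<lambda>z. z * u (z ^ n)) z = 1 + of_nat n * z ^ n * u' / u (z ^ n)"
proof (cases "z = 0")
  case True
  then show ?thesis using n by (simp add: logd_def power_0_left)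
next
  case False
  have "((\<lambda>z. z ^ n) has_field_derivative of_nat n * z ^ (n - 1)) (at z)"
    by (auto intro!: derivative_eq_intros)
  then have "((\<lambda>z. u (z ^ n)) has_field_derivative u' * (of_nat n * z ^ (n - 1))) (at z)"
    by (rule DERIV_chain2[where f = u and g = "\<lambda>z. z ^ n", OF u(1)])
  then have "((\<lambda>z. z * u (z ^ n)) has_field_derivative
      1 * u (z ^ n) + u' * (of_nat n * z ^ (n - 1)) * z) (at z)"
    by (rule DERIV_mult[OF DERIV_ident])
  then have "deriv (\<lambda>z. z * u (z ^ n)) z = 1 * u (z ^ n) + u' * (of_nat n * z ^ (n - 1)) * z"
    by (rule DERIV_imp_deriv)
  also have "\<dots> = u (z ^ n) + of_nat n * z ^ n * u'"
    using n by (cases n) (auto simp: algebra_simps)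
  finally show ?thesis using False u(2) by (simp add: logd_def add_divide_distrib)
qed

text \<open>Cleared of the positive denominator, the inequality is \<open>|w|^2 < 1\<close>.\<close>

lemma Re_divide_one_plus_less:
  fixes w :: complex
  assumes "norm w < 1"
  shows "Re (w / (1 + w)) < 1 / 2"
proof -
  have "Re w \<le> norm w" "- Re w \<le> norm w" using abs_Re_le_cmod[of w] by auto
  have pos: "0 < (1 + Re w)\<^sup>2 + (Im w)\<^sup>2"
    using \<open>- Re w \<le> norm w\<close> assms by (intro add_pos_nonneg) auto
  have "(Re w)\<^sup>2 + (Im w)\<^sup>2 < 1"
    using assms by (metis abs_norm_cancel abs_square_less_1 cmod_power2)
  then show ?thesis
    unfolding Re_divide using pos by (simp add: divide_simps) (simp add: algebra_simps power2_eq_square)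
qed

lemma Re_Cayley_pos:
  fixes w :: complex
  assumes "norm w < 1"
  shows "Re ((1 - w) / (1 + w)) > 0"
proof -
  have "1 + w \<noteq> 0" using assms by (metis add_eq_0_iff2 less_irrefl norm_minus_cancel norm_one)
  then have "(1 - w) / (1 + w) = 1 - (w / (1 + w) + w / (1 + w))" by (simp add: divide_simps)
  then have "Re ((1 - w) / (1 + w)) = 1 - 2 * Re (w / (1 + w))" by (simp only: minus_complex.simps plus_complex.simps one_complex.simps)
  then show ?thesis using Re_divide_one_plus_less[OF assms] by linarith
qed

text \<open>The factors are \<open>g = z * (1 + z ^ n) powr (- 2 * (1 - \<alpha>) / n)\<close> and
  \<open>p = (1 - z ^ n) / (1 + z ^ n)\<close>. At a positive point \<open>t\<close> both disk
  estimates are attained at their leftmost points, so \<open>logd f\<close> is centre minus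
  radius.\<close>

lemma CS_n_extremal:
  assumes n: "1 \<le> n" and \<alpha>: "0 \<le> \<alpha>" "\<alpha> < 1"
  obtains f where "f \<in> CS_n n \<alpha>"
    "\<And>t. 0 < t \<Longrightarrow> t < 1 \<Longrightarrow> logd f (of_real t) =
      of_real (1 + (2 * (1 - \<alpha>) * (t ^ n)\<^sup>2 - 2 * (1 + real n - \<alpha>) * t ^ n) / (1 - (t ^ n)\<^sup>2))"
proof -
  \<comment> \<open>Differentiating \<open>z ^ n\<close> produces a factor \<open>n\<close>, which
    the denominator cancels.\<close>
  define \<beta> where "\<beta> = complex_of_real (2 * (1 - \<alpha>) / real n)"
  \<comment> \<open>The principal branch of \<open>(1 + w)\<close> to the power
    \<open>- \<beta>\<close>, holomorphic because \<open>1 + w\<close> has positive real part on the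
    disk.\<close>
  define u where "u = (\<lambda>w. exp (- \<beta> * Ln (1 + w)))"
  define v where "v = (\<lambda>w::complex. (1 - w) / (1 + w))"
  define g where "g = (\<lambda>z. z * u (z ^ n))"
  define f where "f = (\<lambda>z. z * (u (z ^ n) * v (z ^ n)))"
  have Re1: "0 < Re (1 + w)" if "norm w < 1" for w
    using that abs_Re_le_cmod[of w] by simp
  have nz: "1 + w \<noteq> 0" "1 - w \<noteq> 0" "1 + w \<notin> \<real>\<^sub>\<le>\<^sub>0" if "norm w < 1" for w :: complex
  proof -
    show "1 + w \<noteq> 0" using Re1[OF that] by (metis less_irrefl zero_complex.simps(1))
    show "1 - w \<noteq> 0" using that by auto
    show "1 + w \<notin> \<real>\<^sub>\<le>\<^sub>0" using Re1[OF that] by (auto simp: complex_nonpos_Reals_iff)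
  qed
  have pow: "norm (z ^ n) < 1" if "z \<in> ball (0::complex) 1" for z
    using that n by (simp add: norm_power power_less_one_iff)
  have hu: "u holomorphic_on ball 0 1" unfolding u_def using nz by (intro holomorphic_intros) auto
  have hv: "v holomorphic_on ball 0 1" unfolding v_def using nz by (intro holomorphic_intros) auto
  have u0: "u 0 = 1" "v 0 = 1" by (auto simp: u_def v_def)
  have gA: "g \<in> classA n" unfolding g_def by (rule classA_mult_power[OF hu u0(1) n])
  have fA: "f \<in> classA n" unfolding f_def
    by (rule classA_mult_power[where u = "\<lambda>w. u w * v w"]) (use hu hv u0 n in \<open>auto intro!: holomorphic_intros\<close>)
  have unz: "u w \<noteq> 0" for w by (simp add: u_def)
  have n\<beta>: "of_nat n * \<beta> = of_real (2 * (1 - \<alpha>))" using n by (simp add: \<beta>_def)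
  have du: "(u has_field_derivative u w * (- \<beta> / (1 + w))) (at w)" if "norm w < 1" for w
    unfolding u_def using nz[OF that] by (auto intro!: derivative_eq_intros simp: divide_inverse)
  have dv: "(v has_field_derivative - 2 / (1 + w)\<^sup>2) (at w)" if "norm w < 1" for w
    unfolding v_def using nz[OF that]
    by (auto intro!: derivative_eq_intros simp: power2_eq_square)
  have logdg: "logd g z = 1 - of_real (2 * (1 - \<alpha>)) * (z ^ n / (1 + z ^ n))" if "z \<in> ball 0 1" for z
  proof -
    have "logd g z = 1 + of_nat n * z ^ n * (u (z ^ n) * (- \<beta> / (1 + z ^ n))) / u (z ^ n)"
      unfolding g_def by (rule logd_mult_power[OF du[OF pow[OF that]] unz n])
    then show ?thesis unfolding n\<beta>[symmetric] using unz by (simp add: mult.left_commute)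
  qed
  have "g \<in> starlike_n n \<alpha>"
  proof -
    have "\<alpha> < Re (logd g z)" if "z \<in> ball 0 1" for z
    proof -
      have "2 * (1 - \<alpha>) * Re (z ^ n / (1 + z ^ n)) < 2 * (1 - \<alpha>) * (1 / 2)"
        using Re_divide_one_plus_less[OF pow[OF that]] \<alpha> by (intro mult_strict_left_mono) auto
      moreover have "Re (logd g z) = 1 - 2 * (1 - \<alpha>) * Re (z ^ n / (1 + z ^ n))"
        unfolding logdg[OF that] by (simp only: minus_complex.simps Re_complex_of_real times_complex.simps Im_complex_of_real one_complex.simps)
      ultimately show ?thesis by simp
    qed
    then show ?thesis using gA by (simp add: starlike_n_def)
  qed
  moreover have "quot0 f g \<in> classP n"
  proof -
    have q: "quot0 f g z = v (z ^ n)" for z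
      using n unz by (simp add: quot0_def f_def g_def power_0_left u0)
    obtain h where h: "h holomorphic_on ball 0 1" "\<And>z. z \<in> ball 0 1 \<Longrightarrow> v (z ^ n) = 1 + z ^ n * h z"
      using holomorphic_unit_factor_power[OF hv u0(2) n] by blast
    show ?thesis
    proof (rule classP_I[OF n h(1)])
      show "0 < Re (quot0 f g z)" if "z \<in> ball 0 1" for z
        unfolding q v_def by (rule Re_Cayley_pos[OF pow[OF that]])
    qed (simp add: q h(2))
  qed
  ultimately have "f \<in> CS_n n \<alpha>" using fA by (auto simp: CS_n_def)
  moreover have "logd f (of_real t) =
      of_real (1 + (2 * (1 - \<alpha>) * (t ^ n)\<^sup>2 - 2 * (1 + real n - \<alpha>) * t ^ n) / (1 - (t ^ n)\<^sup>2))"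
    if t: "0 < t" "t < 1" for t
  proof -
    define R where "R = t ^ n"
    have R: "0 < R" "R < 1" using t n by (auto simp: R_def power_less_one_iff)
    define w where "w = complex_of_real R"
    have w: "norm w < 1" using R by (simp add: w_def)
    have tw: "of_real t ^ n = w" by (simp add: w_def R_def)
    have "((\<lambda>w. u w * v w) has_field_derivative u w * (- \<beta> / (1 + w)) * v w + - 2 / (1 + w)\<^sup>2 * u w) (at w)"
      by (rule DERIV_mult[OF du[OF w] dv[OF w]])
    then have "logd f (of_real t) = 1 + of_nat n * w * (u w * (- \<beta> / (1 + w)) * v w + - 2 / (1 + w)\<^sup>2 * u w) / (u w * v w)"
      unfolding f_def using logd_mult_power[of "\<lambda>w. u w * v w" _ "of_real t" n] unz n nz[OF w]
      by (simp add: tw v_def)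
    also have "\<dots> = 1 - of_nat n * \<beta> * w / (1 + w) - 2 * of_nat n * w / ((1 + w) * (1 - w))"
      using unz[of w] nz[OF w] by (simp add: v_def divide_simps) (simp add: algebra_simps power2_eq_square)
    also have "\<dots> = of_real (1 - 2 * (1 - \<alpha>) * R / (1 + R) - 2 * real n * R / ((1 + R) * (1 - R)))"
      unfolding n\<beta> w_def by simp
    also have "1 - 2 * (1 - \<alpha>) * R / (1 + R) - 2 * real n * R / ((1 + R) * (1 - R)) =
        1 + (2 * (1 - \<alpha>) * R\<^sup>2 - 2 * (1 + real n - \<alpha>) * R) / (1 - R\<^sup>2)"
    proof -
      have "1 - R\<^sup>2 = (1 + R) * (1 - R)" by (simp add: algebra_simps power2_eq_square)
      then show ?thesis using R by (simp only:) (simp add: divide_simps, simp add: algebra_simps power2_eq_square)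
    qed
    finally show ?thesis by (simp add: R_def)
  qed
  ultimately show ?thesis using that by blast
qed

subsection \<open>The quadratic equation for the radius\<close>

lemma exp_minus_one_le: "exp (-1) \<le> (2 / 5 :: real)"
proof -
  have "(5 / 2 :: real) \<le> exp 1" using exp_lower_Taylor_quadratic[of 1] by simp
  then have "inverse (exp 1) \<le> inverse (5 / 2 :: real)" by (intro le_imp_inverse_le) auto
  then show ?thesis by (simp add: exp_minus)
qed

text \<open>With \<open>K = N + b\<close> and \<open>s\<close> the square root, \<open>R0\<close> is
  the root \<open>(K - s) / (2 * b - e)\<close> after rationalizing, a form that also covers
  \<open>2 * b = e\<close>. The factorization with positive cofactor makes the sign of the quadratic
  on \<open>[0, 1)\<close> that of \<open>R0 - R\<close>, which serves both the estimate and its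
  sharpness.\<close>

lemma extremal_root:
  fixes e b N :: real
  assumes e: "0 < e" "e \<le> 1" and b: "0 < b" "b \<le> 1" and N: "1 \<le> N"
  defines "R0 \<equiv> e / (sqrt ((N + b)\<^sup>2 - e * (2 * b - e)) + (N + b))"
  shows extremal_root_pos: "0 < R0"
    and extremal_root_le: "R0 \<le> e / (2 + b)"
    and extremal_root_factor:
      "e - 2 * (N + b) * R + (2 * b - e) * R\<^sup>2 = (R0 - R) * (2 * (N + b) - (2 * b - e) * (R + R0))"
    and extremal_root_cofactor_pos:
      "0 \<le> R \<Longrightarrow> R < 1 \<Longrightarrow> 0 < 2 * (N + b) - (2 * b - e) * (R + R0)"
proof -
  define K where "K = N + b"
  define s where "s = sqrt (K\<^sup>2 - e * (2 * b - e))"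
  have "e * (2 * b - e) \<le> e * (2 * b)" using e by (intro mult_left_mono) auto
  also have "\<dots> \<le> 1 * (2 * b)" using e b by (intro mult_right_mono) auto
  finally have "e * (2 * b - e) \<le> 2 * b" by simp
  moreover have "(1 + b)\<^sup>2 \<le> K\<^sup>2" using N b by (intro power_mono) (auto simp: K_def)
  ultimately have disc: "1 \<le> K\<^sup>2 - e * (2 * b - e)"
    using zero_le_power2[of b] unfolding power2_sum power_one by linarith
  then have s1: "1 \<le> s" by (simp add: s_def)
  have s2: "s\<^sup>2 = K\<^sup>2 - e * (2 * b - e)" using disc by (simp add: s_def)
  have R0: "R0 = e / (s + K)" by (simp add: R0_def s_def K_def)
  have K: "1 + b \<le> K" using N by (simp add: K_def)
  show pos: "0 < R0" using e s1 K b by (simp add: R0)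
  show le: "R0 \<le> e / (2 + b)" unfolding R0 using e s1 K b by (intro divide_left_mono) auto
  \<comment> \<open>The first two terms in the bracket collapse to \<open>s^2 - K^2\<close>, which
    is \<open>- e * (2 * b - e)\<close>. By \<open>R0 * (s + K) = e\<close> this is the quadratic at
    \<open>R0\<close> times \<open>(s + K)^2\<close>.\<close>
  have "e * ((s + K)\<^sup>2 - 2 * K * (s + K) + (2 * b - e) * e) = 0"
    using s2 by (simp add: algebra_simps power2_eq_square)
  moreover have "R0 * (s + K) = e" using s1 K b by (simp add: R0)
  moreover have "(s + K)\<^sup>2 * (e - 2 * K * R0 + (2 * b - e) * R0\<^sup>2) =
      e * (s + K)\<^sup>2 - 2 * K * (s + K) * (R0 * (s + K)) + (2 * b - e) * (R0 * (s + K))\<^sup>2"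
    by (simp add: algebra_simps power2_eq_square)
  ultimately have "(s + K)\<^sup>2 * (e - 2 * K * R0 + (2 * b - e) * R0\<^sup>2) = 0"
    by (simp add: algebra_simps power2_eq_square)
  then have root: "e - 2 * K * R0 + (2 * b - e) * R0\<^sup>2 = 0" using s1 K b by simp
  have "e - 2 * K * R + (2 * b - e) * R\<^sup>2 = (R0 - R) * (2 * K - (2 * b - e) * (R + R0))"
    using root by (simp add: algebra_simps power2_eq_square)
  then show "e - 2 * (N + b) * R + (2 * b - e) * R\<^sup>2 = (R0 - R) * (2 * (N + b) - (2 * b - e) * (R + R0))"
    by (simp add: K_def)
  assume R: "0 \<le> R" "R < 1"
  have "e / (2 + b) < 1" using e b by simp
  then have "R + R0 \<le> 2" "0 \<le> R + R0" using R le pos by auto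
  \<comment> \<open>The sign of \<open>2 * b - e\<close> is not fixed; the maximum with 0 treats
    both cases.\<close>
  then have "(2 * b - e) * (R + R0) \<le> max 0 (2 * b - e) * 2"
    by (intro mult_mono) auto
  also have "\<dots> < 2 * (N + b)" using e b N by (auto simp: max_def)
  finally show "0 < 2 * (N + b) - (2 * b - e) * (R + R0)" by simp
qed

text \<open>Makes the centre small enough for \<open>ball_subset_mult_exp_image\<close>. From
  \<open>8 * b \<le> (2 + b)^2\<close> the numerator is at most \<open>e^2 / 4 \<le> e / 10\<close>,
  and \<open>R^2 \<le> 1 / 25\<close>, so there is room below \<open>e / 8\<close>.\<close>

lemma center_le:
  fixes b e R :: real
  assumes "0 < b" "0 < e" "e \<le> 2 / 5" "0 \<le> R" "R \<le> e / (2 + b)"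
  shows "2 * b * R\<^sup>2 / (1 - R\<^sup>2) \<le> e / 8"
proof -
  have "R\<^sup>2 \<le> (e / (2 + b))\<^sup>2" using assms by (intro power_mono) auto
  then have R2: "R\<^sup>2 * (2 + b)\<^sup>2 \<le> e\<^sup>2"
    using assms by (simp add: power_divide pos_le_divide_eq)
  have "8 * b \<le> (2 + b)\<^sup>2"
    using zero_le_power2[of "2 - b"] by (simp add: power2_eq_square algebra_simps)
  then have "R\<^sup>2 * (8 * b) \<le> e\<^sup>2"
    using R2 mult_left_mono[of "8 * b" "(2 + b)\<^sup>2" "R\<^sup>2"] by simp
  moreover have "4 \<le> (2 + b)\<^sup>2" using assms(1) power_mono[of 2 "2 + b" 2] by simp
  then have "R\<^sup>2 * 4 \<le> e\<^sup>2"
    using R2 mult_left_mono[of 4 "(2 + b)\<^sup>2" "R\<^sup>2"] by simp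
  moreover have ee: "e\<^sup>2 \<le> 2 / 5 * e" using assms(2,3) by (simp add: power2_eq_square mult_right_mono)
  ultimately have "R\<^sup>2 \<le> 1 / 25" "2 * b * R\<^sup>2 \<le> e / 10" using assms(3) by (auto simp: mult_ac)
  moreover have "e / 8 * (24 / 25) \<le> e / 8 * (1 - R\<^sup>2)"
    using \<open>R\<^sup>2 \<le> 1 / 25\<close> assms(2) by (intro mult_left_mono) auto
  ultimately have "2 * b * R\<^sup>2 \<le> e / 8 * (1 - R\<^sup>2)" using assms(2) by linarith
  then show ?thesis using \<open>R\<^sup>2 \<le> 1 / 25\<close> by (simp add: pos_divide_le_eq)
qed

theorem mainTheorem8:
  fixes n :: nat and \<alpha> :: real
  assumes "n \<ge> 1" and "0 \<le> \<alpha>" and "\<alpha> < 1"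
  shows "radius (Swp_n n) (CS_n n \<alpha>) =
    ((1 / exp 1) / (sqrt ((1 + real n - \<alpha>)^2 - (1 / exp 1) * (2 * (1 - \<alpha>) - 1 / exp 1))
        + 1 + real n - \<alpha>)) powr (1 / real n)"
proof -
  define e where "e = exp (-1 :: real)"
  define b where "b = 1 - \<alpha>"
  define K where "K = real n + b"
  define R0 where "R0 = e / (sqrt (K\<^sup>2 - e * (2 * b - e)) + K)"
  define r0 where "r0 = R0 powr (1 / real n)"
  have e: "0 < e" "e \<le> 2 / 5" "e \<le> 1" using exp_minus_one_le by (auto simp: e_def)
  have b: "0 < b" "b \<le> 1" using assms by (auto simp: b_def)
  have K: "1 + real n - \<alpha> = K" by (simp add: K_def b_def)
  have n: "1 \<le> real n" using assms by simp
  note root = extremal_root[OF e(1,3) b n, folded K_def, folded R0_def]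
  have R01: "R0 < 1" using root(2) e b by (smt (verit) divide_less_eq_1)
  have "((1 / exp 1) / (sqrt ((1 + real n - \<alpha>)^2 - (1 / exp 1) * (2 * (1 - \<alpha>) - 1 / exp 1))
        + 1 + real n - \<alpha>)) powr (1 / real n) = r0"
  proof -
    have "1 / exp 1 = e" by (simp add: e_def exp_minus inverse_eq_divide)
    moreover have "x + 1 + real n - \<alpha> = x + K" for x by (simp add: K_def b_def)
    ultimately show ?thesis unfolding r0_def R0_def K by (simp only: b_def[symmetric])
  qed
  moreover have "radius (Swp_n n) (CS_n n \<alpha>) = r0"
    unfolding radius_def
  proof (rule Greatest_equality, intro conjI allI impI ballI)
    show r0: "0 < r0" using root(1) by (simp add: r0_def)
    have r0n: "r0 ^ n = R0"
      using root(1) assms(1) r0 by (simp add: r0_def powr_powr flip: powr_realpow)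
    show r01: "r0 \<le> 1" using r0n R01 r0 assms(1) by (smt (verit) one_le_power)
    fix r f assume "0 < r \<and> r \<le> r0" and f: "f \<in> CS_n n \<alpha>"
    then have r: "0 < r" "r \<le> 1" "r \<le> r0" using r01 by auto
    show "dilate r f \<in> Swp_n n"
    proof (rule dilate_in_Swp_n[OF _ assms(1) r(1,2)])
      show "f \<in> classA n" using f by (simp add: CS_n_def)
      show "f z \<noteq> 0" if "z \<in> ball 0 1" "z \<noteq> 0" for z
        by (rule CS_n_nonzero[OF f that])
      fix z :: complex assume z: "norm z < r"
      define R where "R = norm z ^ n"
      define c where "c = 2 * b * R\<^sup>2 / (1 - R\<^sup>2)"
      have "R < r0 ^ n" unfolding R_def using z r assms(1) by (intro power_strict_mono) auto
      then have R: "0 \<le> R" "R < R0" "R < 1" using r0n R01 by (auto simp: R_def)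
      have R2: "0 < 1 - R\<^sup>2" using R by (simp add: abs_square_less_1)
      have "norm (logd f z - 1 - of_real c) \<le> 2 * K * R / (1 - R\<^sup>2)"
        using CS_n_norm_logd_diff_le[OF f assms, of z] z r unfolding K R_def[symmetric]
        by (simp add: c_def b_def)
      also have "\<dots> < c + e"
      proof -
        \<comment> \<open>This quadratic is \<open>(c + e) * (1 - R^2) - 2 * K * R\<close>, so its
          positivity says that the value disk has radius below \<open>c + e\<close>.\<close>
        have "0 < e - 2 * K * R + (2 * b - e) * R\<^sup>2"
          unfolding root(3) using root(4)[of R] R by (intro mult_pos_pos) auto
        then have "2 * K * R < 2 * b * R\<^sup>2 + e * (1 - R\<^sup>2)" by (simp add: algebra_simps)
        then show ?thesis using R2 by (simp add: c_def pos_divide_less_eq distrib_right)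
      qed
      finally have "logd f z - 1 \<in> ball (of_real c) (c + exp (-1))"
        by (simp add: dist_norm norm_minus_commute e_def)
      moreover have "c \<le> exp (-1) / 8"
        unfolding c_def e_def[symmetric] using root(2) R by (intro center_le b e) auto
      moreover have "0 \<le> c" using b R2 by (simp add: c_def)
      ultimately show "logd f z - 1 \<in> (\<lambda>z. z * exp z) ` ball 0 1"
        using ball_subset_mult_exp_image by blast
    qed
  next
    fix y assume y: "0 < y \<and> y \<le> 1 \<and> (\<forall>r. 0 < r \<and> r \<le> y \<longrightarrow> (\<forall>f\<in>CS_n n \<alpha>. dilate r f \<in> Swp_n n))"
    show "y \<le> r0"
    proof (rule ccontr)
      assume "\<not> y \<le> r0"
      \<comment> \<open>A point strictly between: beyond \<open>r0\<close> the extremal value is too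
        small, and below \<open>y\<close> the point \<open>t / y\<close> lies in the open disk,
        where the dilation by \<open>y\<close> takes that value.\<close>
      define t where "t = (r0 + y) / 2"
      have r0: "0 < r0" using root(1) by (simp add: r0_def)
      have r0n: "r0 ^ n = R0"
        using root(1) assms(1) r0 by (simp add: r0_def powr_powr flip: powr_realpow)
      have t: "r0 < t" "t < y" "0 < t" "t < 1" using \<open>\<not> y \<le> r0\<close> y r0 by (auto simp: t_def)
      define R where "R = t ^ n"
      have "r0 ^ n < R" unfolding R_def using t r0 assms(1) by (intro power_strict_mono) auto
      then have R: "R0 < R" "0 \<le> R" "R < 1"
        using r0n t assms(1) by (auto simp: R_def power_less_one_iff)
      have R2: "0 < 1 - R\<^sup>2" using R by (simp add: abs_square_less_1)
      obtain f where f: "f \<in> CS_n n \<alpha>"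
        and logd_f: "logd f (of_real t) = of_real (1 + (2 * b * R\<^sup>2 - 2 * K * R) / (1 - R\<^sup>2))"
        using CS_n_extremal[OF assms] t unfolding K b_def R_def by metis
      have "f holomorphic_on ball 0 1" using f by (simp add: CS_n_def classA_def)
      moreover have "subord (logd (dilate y f)) wp" using y f by (auto simp: Swp_n_def Swp_def)
      moreover have "of_real (t / y) \<in> ball (0::complex) 1" using t y by (simp add: norm_divide)
      ultimately have "logd f (of_real y * of_real (t / y)) - 1 \<in> (\<lambda>z. z * exp z) ` ball 0 1"
        using subord_wp_imp_mem[of "logd (dilate y f)" "of_real (t / y)"] logd_dilate y by metis
      moreover have "of_real y * of_real (t / y) = complex_of_real t" using y by simp
      ultimately have "of_real ((2 * b * R\<^sup>2 - 2 * K * R) / (1 - R\<^sup>2)) \<in> (\<lambda>z::complex. z * exp z) ` ball 0 1"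
        using logd_f by simp
      \<comment> \<open>Beyond the root the quadratic is negative, which puts this real value to the
        left of the minimum \<open>- exp (-1)\<close> of \<open>u * exp u\<close>.\<close>
      moreover have "(2 * b * R\<^sup>2 - 2 * K * R) / (1 - R\<^sup>2) < - exp (-1)"
      proof -
        have "e - 2 * K * R + (2 * b - e) * R\<^sup>2 < 0"
          unfolding root(3) using root(4)[of R] R by (intro mult_neg_pos) auto
        then have "2 * b * R\<^sup>2 - 2 * K * R < - e * (1 - R\<^sup>2)" by (simp add: algebra_simps)
        then show ?thesis using R2 by (simp add: pos_divide_less_eq e_def)
      qed
      ultimately show False using of_real_notin_mult_exp_image by blast
    qed
  qed
  ultimately show ?thesis by simp
qed

end
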